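(* Let $\alpha>0$, let $u,v,\varphi\in H(\mathbb{D})$ with $\varphi(\mathbb{D})\subseteq\mathbb{D}$. Then the following are equivalent: (i) the operator $T^2_{u,v,\varphi}:B_1\to\mathcal{Z}_\alpha$ is bounded; (ii) for each $j\in\{1,\dots,5\}$, $\sup_{a\in\mathbb{D}}\|T^2_{u,v,\varphi}f_{j,a}\|_{\mathcal{Z}_\alpha}<\infty$, and $$\sup_{z\in\mathbb{D}}(1-|z|^2)^\alpha\big(|u''(z)|+|(2u'\varphi'+u\varphi'')(z)|+|(u(\varphi')^2+v'')(z)|\big)<\infty,$$ $$\sup_{z\in\mathbb{D}}(1-|z|^2)^\alpha\big(|(2v'\varphi'+v\varphi'')(z)|+|(v(\varphi')^2)(z)|\big)<\infty;$$ (iii) $$\sup_{z\in\mathbb{D}}(1-|z|^2)^\alpha\Big(|u''(z)|+\frac{|(2u'\varphi'+u\varphi'')(z)|}{1-|\varphi(z)|^2}+\frac{|(u(\varphi')^2+v'')(z)|}{(1-|\varphi(z)|^2)^2}\Big)<\infty,$$ $$\sup_{z\in\mathbb{D}}(1-|z|^2)^\alpha\Big(\frac{|(2v'\varphi'+v\varphi'')(z)|}{(1-|\varphi(z)|^2)^3}+\frac{|(v(\varphi')^2)(z)|}{(1-|\varphi(z)|^2)^4}\Big)<\infty.$$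
   Context: $\mathbb{D}$ is the open unit disc and $H(\mathbb{D})$ the space of analytic functions on $\mathbb{D}$. For $\alpha>0$, $\mathcal{Z}_\alpha$ consists of $f\in H(\mathbb{D})$ with $\sup_{z}(1-|z|^2)^\alpha|f''(z)|<\infty$, with norm $\|f\|_{\mathcal{Z}_\alpha}=|f(0)|+|f'(0)|+\sup_{z}(1-|z|^2)^\alpha|f''(z)|$. $B_1$ (minimal Möbius invariant space) is the space of $f=\sum_k c_k\sigma_{a_k}$, $a_k\in\mathbb{D}$, $\sum|c_k|<\infty$, $\sigma_a(z)=\frac{a-z}{1-\bar az}$, with norm the infimum of $\sum|c_k|$; equivalently $f\in H(\mathbb{D})$ with $f''\in L^1(\mathbb{D},dA)$, norm comparable to $|f(0)|+|f'(0)|+\int_{\mathbb{D}}|f''|dA$. $T^2_{u,v,\varphi}f(z)=u(z)f(\varphi(z))+v(z)f''(\varphi(z))$. For $j\in\mathbb{N}$, $a\in\mathbb{D}$: $f_{j,a}(z)=\left(\frac{1-|a|^2}{1-\bar az}\right)^j$. *)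

theory Defs
  imports "HOL-Analysis.Analysis"
begin

definition disc :: "complex set" where
  "disc = ball 0 1"

definition Z_norm :: "real \<Rightarrow> (complex \<Rightarrow> complex) \<Rightarrow> ennreal" where
  "Z_norm \<alpha> f = ennreal (norm (f 0)) + ennreal (norm (deriv f 0))
     + (SUP z\<in>disc. ennreal ((1 - (norm z)\<^sup>2) powr \<alpha> * norm (deriv (deriv f) z)))"

text \<open>Norm of the minimal Moebius invariant space B_1 (the equivalent integral norm,
  with dA the normalized area measure); B_1 = holomorphic f on the disc with finite norm.\<close>
definition B1_norm :: "(complex \<Rightarrow> complex) \<Rightarrow> ennreal" where
  "B1_norm f = ennreal (norm (f 0)) + ennreal (norm (deriv f 0))
     + ennreal (1 / pi) * (\<integral>\<^sup>+ z. indicator disc z * ennreal (norm (deriv (deriv f) z)) \<partial>lborel)"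

definition in_B1 :: "(complex \<Rightarrow> complex) \<Rightarrow> bool" where
  "in_B1 f \<longleftrightarrow> f holomorphic_on disc \<and> B1_norm f < \<infinity>"

definition T2 :: "(complex \<Rightarrow> complex) \<Rightarrow> (complex \<Rightarrow> complex) \<Rightarrow> (complex \<Rightarrow> complex)
     \<Rightarrow> (complex \<Rightarrow> complex) \<Rightarrow> complex \<Rightarrow> complex" where
  "T2 u v \<phi> f = (\<lambda>z. u z * f (\<phi> z) + v z * deriv (deriv f) (\<phi> z))"

definition T2_bounded :: "real \<Rightarrow> (complex \<Rightarrow> complex) \<Rightarrow> (complex \<Rightarrow> complex)
     \<Rightarrow> (complex \<Rightarrow> complex) \<Rightarrow> bool" where
  "T2_bounded \<alpha> u v \<phi> \<longleftrightarrow> (\<exists>C::real. \<forall>f. in_B1 f \<longrightarrow>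
      T2 u v \<phi> f holomorphic_on disc \<and> Z_norm \<alpha> (T2 u v \<phi> f) \<le> ennreal C * B1_norm f)"

definition f_test :: "nat \<Rightarrow> complex \<Rightarrow> complex \<Rightarrow> complex" where
  "f_test j a = (\<lambda>z. ((1 - (complex_of_real (norm a))\<^sup>2) / (1 - cnj a * z)) ^ j)"

end

theory Submission
  imports Defs "HOL-Complex_Analysis.Complex_Analysis"
begin

text \<open>The second derivative of \<open>T f\<close> is \<open>\<Sum>\<^sub>k A\<^sub>k f\<^bsup>(k)\<^esup> \<circ> \<phi>\<close> with \<open>k \<le> 4\<close> and coefficients \<open>A\<^sub>k\<close> built from
  \<open>u, v, \<phi>\<close>; condition (iii) says that each \<open>A\<^sub>k / (1 - \<bar>\<phi>\<bar>\<^sup>2)\<^sup>k\<close> is bounded against the weight.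
  It suffices for (i) because \<open>B\<^sub>1\<close> embeds into the bounded functions: write \<open>f(w)\<close> by Taylor's formula as an
  integral of \<open>(1 - t) f''(t w)\<close> along the radius, dominate \<open>f''\<close> by its mean over a disc of radius comparable to
  the distance to the boundary, and interchange the integrals. Cauchy's inequality then controls all derivatives.
  Conversely, the functions \<open>f\<^bsub>j,a\<^esub>\<close> are bounded in \<open>B\<^sub>1\<close>, and the monomials \<open>z\<^sup>m\<close> with \<open>m \<le> 4\<close> bound the \<open>A\<^sub>k\<close>
  one after the other, which is (ii). Finally, testing at \<open>a = \<phi> z\<close> gives for
  \<open>X\<^sub>k = A\<^sub>k (cnj a / (1 - \<bar>a\<bar>\<^sup>2))\<^sup>k\<close> a linear system with matrix \<open>pochhammer j k\<close>, invertible for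
  \<open>j = 1, \<dots>, 5\<close>; this gives (iii) where \<open>\<bar>\<phi> z\<bar> \<ge> 1/2\<close>, and elsewhere the bounds on the \<open>A\<^sub>k\<close> suffice.\<close>

section \<open>Mean values over discs\<close>

lemma nn_integral_lborel_shift:
  fixes c :: "'a::euclidean_space" and F :: "'a \<Rightarrow> ennreal"
  assumes [measurable]: "F \<in> borel_measurable borel"
  shows "(\<integral>\<^sup>+x. F (x + c) \<partial>lborel) = (\<integral>\<^sup>+x. F x \<partial>lborel)"
proof -
  have "(\<integral>\<^sup>+x. F x \<partial>lborel) = (\<integral>\<^sup>+x. F x \<partial>distr lborel borel (\<lambda>x. c + 1 *\<^sub>R x))"
    by (subst lborel_affine[of 1 c]) (simp_all add: density_1)
  also have "\<dots> = (\<integral>\<^sup>+x. F (x + c) \<partial>lborel)"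
    by (subst nn_integral_distr) (simp_all add: add.commute)
  finally show ?thesis by simp
qed

text \<open>Fubini for \<open>(x, y) \<mapsto> 1\<^bsub>B\<^esub>(y) F (f x + y)\<close> with \<open>B\<close> the unit ball: only translations are
  needed, because \<open>f\<close> is linear and preserves \<open>B\<close>.\<close>
lemma nn_integral_lborel_orthogonal:
  fixes f :: "'a::euclidean_space \<Rightarrow> 'a" and F :: "'a \<Rightarrow> ennreal"
  assumes f: "orthogonal_transformation f" and [measurable]: "F \<in> borel_measurable borel"
  shows "(\<integral>\<^sup>+x. F (f x) \<partial>lborel) = (\<integral>\<^sup>+x. F x \<partial>lborel)"
proof -
  define B :: "'a set" where "B = ball 0 1"
  define V where "V = emeasure lborel B"
  have lin: "linear f" using f by (rule orthogonal_transformation_linear)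
  have nrm: "norm (f x) = norm x" for x using f by (rule orthogonal_transformation_norm)
  have [measurable]: "f \<in> borel_measurable borel"
    by (intro borel_measurable_continuous_onI linear_continuous_on
          linear_conv_bounded_linear[THEN iffD1] lin)
  have Bm [measurable]: "B \<in> sets borel" by (simp add: B_def)
  have V0: "V \<noteq> 0" "V \<noteq> \<infinity>"
    using content_ball_pos[of 1 "0::'a"] emeasure_lborel_ball_finite[of "0::'a" 1]
    unfolding V_def B_def measure_def by auto
  obtain g where g: "f (g y) = y" for y
    using orthogonal_transformation_surj[OF f] by (metis surjD)
  \<comment> \<open>By linearity, adding \<open>y\<close> to the value of \<open>f\<close> is adding
    \<open>g y\<close> to its argument. The integral is thus the same for every \<open>y\<close>,
    and it may be averaged over \<open>B\<close>.\<close>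
  have tr: "(\<integral>\<^sup>+x. F (f x) \<partial>lborel) = (\<integral>\<^sup>+x. F (f x + y) \<partial>lborel)" for y
    using nn_integral_lborel_shift[of "\<lambda>x. F (f x)" "g y"] linear_add[OF lin] by (simp add: g)
  have "(\<integral>\<^sup>+x. F (f x) \<partial>lborel) * V = (\<integral>\<^sup>+y. indicator B y * (\<integral>\<^sup>+x. F (f x) \<partial>lborel) \<partial>lborel)"
    by (subst nn_integral_multc) (simp_all add: V_def mult.commute)
  also have "\<dots> = (\<integral>\<^sup>+y. indicator B y * (\<integral>\<^sup>+x. F (f x + y) \<partial>lborel) \<partial>lborel)"
    using tr by simp
  also have "\<dots> = (\<integral>\<^sup>+y. (\<integral>\<^sup>+x. indicator B y * F (f x + y) \<partial>lborel) \<partial>lborel)"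
    by (intro nn_integral_cong nn_integral_cmult[symmetric]) simp
  also have "\<dots> = (\<integral>\<^sup>+x. (\<integral>\<^sup>+y. indicator B y * F (f x + y) \<partial>lborel) \<partial>lborel)"
    by (rule lborel_pair.Fubini') simp
  also have "\<dots> = (\<integral>\<^sup>+x. (\<integral>\<^sup>+y. indicator B (y - f x) * F y \<partial>lborel) \<partial>lborel)"
  proof (rule nn_integral_cong)
    fix x
    show "(\<integral>\<^sup>+y. indicator B y * F (f x + y) \<partial>lborel) = (\<integral>\<^sup>+y. indicator B (y - f x) * F y \<partial>lborel)"
      using nn_integral_lborel_shift[of "\<lambda>y. indicator B (y - f x) * F y" "f x"]
      by (simp add: add.commute)
  qed
  also have "\<dots> = (\<integral>\<^sup>+y. (\<integral>\<^sup>+x. indicator B (y - f x) * F y \<partial>lborel) \<partial>lborel)"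
    by (rule lborel_pair.Fubini'[symmetric]) simp
  also have "\<dots> = (\<integral>\<^sup>+y. F y * V \<partial>lborel)"
  proof (rule nn_integral_cong)
    fix y
    have "indicator B (y - f x) = (indicator (ball (g y) 1) x :: ennreal)" for x
    proof -
      have "y - f x = f (g y - x)" by (simp add: linear_diff[OF lin] g)
      then show ?thesis by (simp add: indicator_def B_def dist_norm nrm)
    qed
    then have "(\<integral>\<^sup>+x. indicator B (y - f x) * F y \<partial>lborel) = emeasure lborel (ball (g y) 1) * F y"
      by (simp, subst nn_integral_multc) (simp_all add: borel_measurable_indicator)
    then show "(\<integral>\<^sup>+x. indicator B (y - f x) * F y \<partial>lborel) = F y * V"
      by (simp add: V_def B_def emeasure_ball mult.commute)
  qed
  also have "\<dots> = (\<integral>\<^sup>+y. F y \<partial>lborel) * V" by (simp add: nn_integral_multc)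
  finally show ?thesis using V0 by (simp add: ennreal_mult_cancel_left mult.commute[of _ V])
qed

section \<open>From circle means to area means\<close>

text \<open>Cauchy's and Taylor's formulas produce gauge integrals, while the interchanges of
  integrals below take place for \<open>nn_integral\<close>. This estimate is the bridge.\<close>

lemma norm_has_integral_le_nn_integral:
  fixes g :: "real \<Rightarrow> 'a::euclidean_space"
  assumes "(g has_integral I) {a..b}" "continuous_on {a..b} g"
  shows "ennreal (norm I) \<le> (\<integral>\<^sup>+t. indicator {a..b} t * ennreal (norm (g t)) \<partial>lborel)"
proof -
  have ng: "(\<lambda>t. norm (g t)) integrable_on {a..b}"
    using assms(2) by (intro integrable_continuous_real continuous_intros)
  have "norm I \<le> integral {a..b} (\<lambda>t. norm (g t))"
    using integral_norm_bound_integral[OF has_integral_integrable[OF assms(1)] ng]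
    by (simp add: integral_unique[OF assms(1)])
  also have "ennreal (integral {a..b} (\<lambda>t. norm (g t)))
      = (\<integral>\<^sup>+t. ennreal (indicator {a..b} t * norm (g t)) \<partial>lborel)"
    using nn_integral_has_integral_lebesgue[OF _ integrable_integral[OF ng]] by simp
  also have "\<dots> = (\<integral>\<^sup>+t. indicator {a..b} t * ennreal (norm (g t)) \<partial>lborel)"
    by (intro nn_integral_cong) (simp add: indicator_def)
  finally show ?thesis by (simp add: ennreal_leI)
qed

text \<open>Cauchy's formula at the centre: the speed of the circle contributes a factor
  \<open>e t\<close> that cancels the denominator, which leaves the mean value property.\<close>

lemma holomorphic_unit_circle_submean:
  assumes h: "h holomorphic_on cball 0 1"
  shows "ennreal (norm (h 0))
     \<le> (\<integral>\<^sup>+t. indicator {0..1} t * ennreal (norm (h (exp (2 * of_real pi * \<i> * of_real t)))) \<partial>lborel)"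
proof -
  define e where "e t = exp (2 * of_real pi * \<i> * of_real t)" for t :: real
  have "((\<lambda>u. h u / (u - 0)) has_contour_integral 2 * of_real pi * \<i> * h 0) (circlepath 0 1)"
    by (rule Cauchy_integral_circlepath_simple[OF h]) simp
  then have "((\<lambda>t. h (e t) / e t * (2 * of_real pi * \<i> * e t)) has_integral 2 * of_real pi * \<i> * h 0) {0..1}"
    unfolding has_contour_integral_def
    by (rule has_integral_eq[rotated])
       (simp only: vector_derivative_circlepath01 atLeastAtMost_iff, simp add: circlepath e_def)
  then have "((\<lambda>t. h (e t) * (2 * of_real pi * \<i>)) has_integral 2 * of_real pi * \<i> * h 0) {0..1}"
    by (rule has_integral_eq[rotated]) (simp add: e_def)
  from has_integral_mult_left[OF this, of "inverse (2 * of_real pi * \<i>)"]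
  have "((\<lambda>t. h (e t)) has_integral h 0) {0..1}"
    by (simp add: field_simps)
  moreover have "continuous_on {0..1} (\<lambda>t. h (e t))"
    by (rule continuous_on_compose2[OF holomorphic_on_imp_continuous_on[OF h]])
       (auto simp: e_def intro!: continuous_intros)
  ultimately show ?thesis
    unfolding e_def[symmetric] by (rule norm_has_integral_le_nn_integral)
qed

lemma borel_measurable_indicator_norm:
  fixes g :: "'a::topological_space \<Rightarrow> 'b::real_normed_vector"
  assumes "open S" "continuous_on S g"
  shows "(\<lambda>z. indicator S z * ennreal (norm (g z))) \<in> borel_measurable borel"
proof -
  have "(\<lambda>z. indicator S z *\<^sub>R g z) \<in> borel_measurable borel"
    using assms by (intro borel_measurable_continuous_on_indicator) simp_all
  then have "(\<lambda>z. ennreal (norm (indicator S z *\<^sub>R g z))) \<in> borel_measurable borel"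
    by measurable
  also have "(\<lambda>z. ennreal (norm (indicator S z *\<^sub>R g z))) = (\<lambda>z. indicator S z * ennreal (norm (g z)))"
    by (auto simp: indicator_def)
  finally show ?thesis .
qed

text \<open>Rotations replace polar coordinates. For each \<zeta> in the ball about 0, the circle
  estimate applies to \<open>h (w + \<eta> * \<zeta>)\<close> as a function of \<eta>. Integrating
  over \<zeta> and interchanging the integrals leaves inner integrals that are independent of the
  angle.\<close>

lemma holomorphic_area_submean:
  fixes h :: "complex \<Rightarrow> complex"
  assumes h: "h holomorphic_on ball w r" and r: "r > 0"
  shows "ennreal (pi * r\<^sup>2) * ennreal (norm (h w))
     \<le> (\<integral>\<^sup>+z. indicator (ball w r) z * ennreal (norm (h z)) \<partial>lborel)"
proof -
  define e where "e t = exp (2 * of_real pi * \<i> * of_real t)" for t :: real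
  define G where "G z = indicator (ball w r) z * ennreal (norm (h z))" for z
  have ne: "norm (e t) = 1" for t by (simp add: e_def)
  have [measurable]: "e \<in> borel_measurable borel"
    unfolding e_def by (intro borel_measurable_continuous_onI continuous_intros)
  have [measurable]: "G \<in> borel_measurable borel"
    unfolding G_def by (intro borel_measurable_indicator_norm holomorphic_on_imp_continuous_on h) simp
  have circ: "indicator (ball 0 r) \<zeta> * ennreal (norm (h w))
      \<le> (\<integral>\<^sup>+t. indicator {0..1} t * G (w + e t * \<zeta>) \<partial>lborel)" for \<zeta>
  proof (cases "\<zeta> \<in> ball 0 r")
    case True
    have "ennreal (norm (h (w + 0 * \<zeta>)))
       \<le> (\<integral>\<^sup>+t. indicator {0..1} t * ennreal (norm (h (w + e t * \<zeta>))) \<partial>lborel)"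
      unfolding e_def
    proof (rule holomorphic_unit_circle_submean[of "\<lambda>\<eta>. h (w + \<eta> * \<zeta>)"])
      have "norm \<eta> \<le> 1 \<Longrightarrow> norm \<eta> * norm \<zeta> < r" for \<eta> :: complex
        using True mult_right_mono[of "norm \<eta>" 1 "norm \<zeta>"] by auto
      then have "(\<lambda>\<eta>. w + \<eta> * \<zeta>) ` cball 0 1 \<subseteq> ball w r"
        by (auto simp: dist_norm norm_mult)
      then show "(\<lambda>\<eta>. h (w + \<eta> * \<zeta>)) holomorphic_on cball 0 1"
        by (intro holomorphic_on_compose_gen[OF _ h, unfolded o_def] holomorphic_intros)
    qed
    also have "\<dots> = (\<integral>\<^sup>+t. indicator {0..1} t * G (w + e t * \<zeta>) \<partial>lborel)"
      using True by (intro nn_integral_cong) (simp add: G_def dist_norm norm_mult ne)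
    finally show ?thesis using True by simp
  qed simp
  have rot: "(\<integral>\<^sup>+\<zeta>. G (w + e t * \<zeta>) \<partial>lborel) = (\<integral>\<^sup>+\<zeta>. G \<zeta> \<partial>lborel)" for t
  proof -
    \<comment> \<open>Multiplication by a number of modulus 1 is a rotation of the plane.\<close>
    have "orthogonal_transformation (\<lambda>\<zeta>. e t * \<zeta>)"
      unfolding orthogonal_transformation
      by (auto simp: norm_mult ne intro!: linearI simp: algebra_simps scaleR_conv_of_real)
    from nn_integral_lborel_orthogonal[OF this, of "\<lambda>\<zeta>. G (\<zeta> + w)"]
    show ?thesis by (simp add: add.commute nn_integral_lborel_shift)
  qed
  have "ennreal (pi * r\<^sup>2) * ennreal (norm (h w)) = (\<integral>\<^sup>+\<zeta>. indicator (ball (0::complex) r) \<zeta> * ennreal (norm (h w)) \<partial>lborel)"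
    using r by (subst nn_integral_multc) (simp_all add: emeasure_ball unit_ball_vol_2 borel_measurable_indicator)
  also have "\<dots> \<le> (\<integral>\<^sup>+\<zeta>. (\<integral>\<^sup>+t. indicator {0..1} t * G (w + e t * \<zeta>) \<partial>lborel) \<partial>lborel)"
    by (intro nn_integral_mono circ)
  also have "\<dots> = (\<integral>\<^sup>+t. (\<integral>\<^sup>+\<zeta>. indicator {0..1} t * G (w + e t * \<zeta>) \<partial>lborel) \<partial>lborel)"
    by (rule lborel_pair.Fubini') simp
  also have "\<dots> = (\<integral>\<^sup>+t. indicator {0..1} t * (\<integral>\<^sup>+\<zeta>. G (w + e t * \<zeta>) \<partial>lborel) \<partial>lborel)"
    by (intro nn_integral_cong nn_integral_cmult) simp
  also have "\<dots> = (\<integral>\<^sup>+z. G z \<partial>lborel)"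
    by (simp add: rot nn_integral_multc)
  finally show ?thesis by (simp add: G_def)
qed

section \<open>Boundedness of functions in the minimal space\<close>

lemma mem_disc_iff: "z \<in> disc \<longleftrightarrow> norm z < 1"
  by (simp add: disc_def)

lemma open_disc [simp]: "open disc"
  by (simp add: disc_def)

text \<open>A point \<open>\<zeta>\<close> lies in the disc of radius \<open>(1 - t \<bar>w\<bar>) / 2\<close> about \<open>t w\<close> only for \<open>t\<close> in an
  interval of length at most \<open>4 (1 - \<bar>\<zeta>\<bar>) / (3 \<bar>w\<bar>)\<close>, and there \<open>1 - t \<bar>w\<bar>\<close> is comparable to \<open>1 - \<bar>\<zeta>\<bar>\<close>.\<close>
lemma radial_kernel_bound:
  fixes w \<zeta> :: complex
  assumes w: "norm w < 1" and z: "norm \<zeta> < 1"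
  shows "(\<integral>\<^sup>+t. indicator {0..1} t * (ennreal ((norm w)\<^sup>2 * (4 / (pi * (1 - t * norm w))))
        * indicator (ball (t * w) ((1 - t * norm w) / 2)) \<zeta>) \<partial>lborel) \<le> ennreal (8 / pi)"
    (is "(\<integral>\<^sup>+t. ?K t \<partial>lborel) \<le> _")
proof (cases "w = 0")
  case False
  define \<rho> where "\<rho> = norm w"
  define d where "d = 1 - norm \<zeta>"
  have \<rho>: "0 < \<rho>" "\<rho> < 1" and d: "0 < d" using False w z by (auto simp: \<rho>_def d_def)
  \<comment> \<open>Where the kernel does not vanish,
    \<open>2 * d / 3 < 1 - t * \<rho> < 2 * d\<close>. The lower bound turns the constant 4 into 6,
    and both together give the interval for \<open>t\<close>. The factor
    \<open>\<rho>\<^sup>2\<close> absorbs the \<open>1 / \<rho>\<close> in the length of the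
    interval.\<close>
  have "?K t \<le> ennreal (6 * \<rho>\<^sup>2 / (pi * d)) * indicator {(1 - 2 * d) / \<rho> .. (1 - 2 * d / 3) / \<rho>} t" for t
  proof (cases "t \<in> {0..1} \<and> \<zeta> \<in> ball (t * w) ((1 - t * norm w) / 2)")
    case True
    then have t: "0 \<le> t" "t \<le> 1" and b: "norm (t * w - \<zeta>) < (1 - t * \<rho>) / 2"
      by (auto simp: \<rho>_def dist_norm)
    have nt: "norm (t * w) = t * \<rho>" using t by (simp add: norm_mult \<rho>_def)
    have "norm \<zeta> \<le> t * \<rho> + norm (t * w - \<zeta>)" "t * \<rho> \<le> norm \<zeta> + norm (t * w - \<zeta>)"
      using norm_triangle_ineq4[of "t * w" "t * w - \<zeta>"] norm_triangle_ineq[of \<zeta> "t * w - \<zeta>"]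
      by (simp_all add: nt)
    with b have c: "1 - t * \<rho> < 2 * d" "2 * d / 3 < 1 - t * \<rho>"
      by (simp_all add: d_def field_simps)
    have "\<rho>\<^sup>2 * (4 / (pi * (1 - t * \<rho>))) \<le> \<rho>\<^sup>2 * (4 / (pi * (2 * d / 3)))"
      using c d by (intro mult_left_mono divide_left_mono mult_pos_pos) auto
    then have "\<rho>\<^sup>2 * (4 / (pi * (1 - t * \<rho>))) \<le> 6 * \<rho>\<^sup>2 / (pi * d)"
      by (simp add: mult.commute)
    moreover have "t \<in> {(1 - 2 * d) / \<rho> .. (1 - 2 * d / 3) / \<rho>}"
      using c \<rho> by (auto simp: field_simps)
    ultimately show ?thesis using True by (simp add: \<rho>_def[symmetric] ennreal_leI)
  next
    case False
    then have "?K t = 0" by (auto simp: indicator_def)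
    then show ?thesis by (simp only: zero_le)
  qed
  then have "(\<integral>\<^sup>+t. ?K t \<partial>lborel)
      \<le> (\<integral>\<^sup>+t. ennreal (6 * \<rho>\<^sup>2 / (pi * d)) * indicator {(1 - 2 * d) / \<rho> .. (1 - 2 * d / 3) / \<rho>} t \<partial>lborel)"
    by (rule nn_integral_mono)
  also have "\<dots> = ennreal (6 * \<rho>\<^sup>2 / (pi * d)) * ennreal ((1 - 2 * d / 3) / \<rho> - (1 - 2 * d) / \<rho>)"
    using d \<rho> by (subst nn_integral_cmult_indicator) (simp_all add: divide_right_mono)
  also have "\<dots> = ennreal (8 * \<rho> / pi)"
    using d \<rho> by (subst ennreal_mult[symmetric]) (auto simp: field_simps power2_eq_square)
  also have "\<dots> \<le> ennreal (8 / pi)"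
    using \<rho> by (intro ennreal_leI divide_right_mono) auto
  finally show ?thesis .
qed simp

lemma radial_taylor:
  assumes f: "f holomorphic_on disc" and w: "w \<in> disc"
  shows "((\<lambda>t. of_real (1 - t) * w\<^sup>2 * deriv (deriv f) (of_real t * w)) has_integral
            f w - f 0 - w * deriv f 0) {0..1}"
proof -
  have f': "deriv f holomorphic_on disc" using f by (simp add: holomorphic_deriv)
  have tw: "of_real t * w \<in> disc" if "t \<in> {0..1}" for t :: real
    using that w mult_right_mono[of t 1 "norm w"] by (auto simp: mem_disc_iff norm_mult)
  \<comment> \<open>An antiderivative of the integrand: on differentiation the two terms with f'
    cancel. It equals \<open>f w\<close> at 1 and \<open>f 0 + w * deriv f 0\<close> at 0. Below,
    \<open>?G\<close> is its extension to complex arguments, to which the complex chain rule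
    applies.\<close>
  define g where "g t = f (of_real t * w) + of_real (1 - t) * w * deriv f (of_real t * w)" for t :: real
  have "((\<lambda>t. of_real (1 - t) * w\<^sup>2 * deriv (deriv f) (of_real t * w)) has_integral g 1 - g 0) {0..1}"
  proof (rule fundamental_theorem_of_calculus)
    fix t :: real assume t: "t \<in> {0..1}"
    let ?G = "\<lambda>z. f (z * w) + (1 - z) * w * deriv f (z * w)"
    have "(f has_field_derivative deriv f (of_real t * w)) (at (of_real t * w))"
         "(deriv f has_field_derivative deriv (deriv f) (of_real t * w)) (at (of_real t * w))"
      using f f' tw[OF t] by (auto intro: holomorphic_derivI[OF _ open_disc])
    note D = this[THEN DERIV_chain2[of _ _ "\<lambda>z. z * w"]]
    have "(?G has_field_derivative (1 - of_real t) * w\<^sup>2 * deriv (deriv f) (of_real t * w)) (at (of_real t))"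
      by (auto intro!: derivative_eq_intros D simp: algebra_simps power2_eq_square)
    from has_vector_derivative_real_field[OF this]
    show "(g has_vector_derivative of_real (1 - t) * w\<^sup>2 * deriv (deriv f) (of_real t * w)) (at t within {0..1})"
      by (simp add: g_def[abs_def])
  qed simp
  then show ?thesis by (simp add: g_def algebra_simps)
qed

text \<open>The constant 8 comes from the kernel bound \<open>8 / pi\<close>, because the area
  integral in \<open>B1_norm\<close> carries the factor \<open>1 / pi\<close>.\<close>

lemma B1_sup_bound:
  assumes f: "f holomorphic_on disc" and w: "w \<in> disc"
  shows "ennreal (norm (f w)) \<le> 8 * B1_norm f"
proof -
  define N where "N = (\<integral>\<^sup>+ z. indicator disc z * ennreal (norm (deriv (deriv f) z)) \<partial>lborel)"
  define G where "G z = indicator disc z * ennreal (norm (deriv (deriv f) z))" for z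
  \<comment> \<open>With \<open>r = (1 - t * norm w) / 2\<close> one has
    \<open>1 - t \<le> 2 * r\<close>, so the Taylor weight is at most
    \<open>2 * r * (norm w)\<^sup>2\<close>. Division by the area \<open>pi * r\<^sup>2\<close> of
    the averaging disc gives \<open>c t\<close>.\<close>
  define c where "c t = (norm w)\<^sup>2 * (4 / (pi * (1 - t * norm w)))" for t
  have f'': "deriv (deriv f) holomorphic_on disc" using f by (simp add: holomorphic_deriv)
  have [measurable]: "G \<in> borel_measurable borel"
    unfolding G_def by (intro borel_measurable_indicator_norm holomorphic_on_imp_continuous_on f'') simp
  have [measurable]: "c \<in> borel_measurable borel" unfolding c_def by measurable
  have w1: "norm w < 1" using w by (simp add: mem_disc_iff)
  have tw: "t * norm w \<le> norm w" if "t \<in> {0..1}" for t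
    using that mult_right_mono[of t 1 "norm w"] by simp
  have m: "(\<lambda>(\<zeta>, t). indicator {0..1} t * (ennreal (c t) * (indicator (ball (t * w) ((1 - t * norm w) / 2)) \<zeta> * G \<zeta>)))
      \<in> borel_measurable (lborel \<Otimes>\<^sub>M lborel)"
  proof -
    \<comment> \<open>The averaging disc moves with \<open>t\<close>, so Fubini requires the
      incidence relation to be measurable jointly in \<zeta> and \<open>t\<close>.\<close>
    have "Measurable.pred (borel \<Otimes>\<^sub>M borel) (\<lambda>x. dist (complex_of_real (snd x) * w) (fst x) < (1 - snd x * norm w) / 2)"
      by measurable
    then show ?thesis unfolding indicator_def[of "ball _ _"] by simp
  qed
  have "ennreal (norm (f w - f 0 - w * deriv f 0))
     \<le> (\<integral>\<^sup>+t. indicator {0..1} t * ennreal (norm (of_real (1 - t) * w\<^sup>2 * deriv (deriv f) (of_real t * w))) \<partial>lborel)"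
  proof (rule norm_has_integral_le_nn_integral[OF radial_taylor[OF f w]])
    have "(\<lambda>t. of_real t * w) ` {0..1} \<subseteq> disc"
      using tw w1 by (fastforce simp: mem_disc_iff norm_mult)
    then show "continuous_on {0..1} (\<lambda>t. of_real (1 - t) * w\<^sup>2 * deriv (deriv f) (of_real t * w))"
      by (intro continuous_intros continuous_on_compose2[OF holomorphic_on_imp_continuous_on[OF f'']])
  qed
  also have "\<dots> \<le> (\<integral>\<^sup>+t. (\<integral>\<^sup>+\<zeta>. indicator {0..1} t * (ennreal (c t) * (indicator (ball (t * w) ((1 - t * norm w) / 2)) \<zeta> * G \<zeta>)) \<partial>lborel) \<partial>lborel)"
  proof (rule nn_integral_mono)
    fix t :: real
    show "indicator {0..1} t * ennreal (norm (of_real (1 - t) * w\<^sup>2 * deriv (deriv f) (of_real t * w)))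
      \<le> (\<integral>\<^sup>+\<zeta>. indicator {0..1} t * (ennreal (c t) * (indicator (ball (t * w) ((1 - t * norm w) / 2)) \<zeta> * G \<zeta>)) \<partial>lborel)"
    proof (cases "t \<in> {0..1}")
      case True
      define r where "r = (1 - t * norm w) / 2"
      have r: "r > 0" and t: "0 \<le> t" "t \<le> 1" using tw[OF True] w1 True by (auto simp: r_def)
      have sub: "ball (of_real t * w) r \<subseteq> disc"
      proof
        fix z assume "z \<in> ball (of_real t * w) r"
        then have "norm z < r + norm (of_real t * w)"
          using norm_triangle_ineq2[of z "of_real t * w"] by (simp add: dist_norm norm_minus_commute)
        also have "\<dots> \<le> 1" using t r unfolding r_def by (simp add: norm_mult field_simps)
        finally show "z \<in> disc" by (simp add: mem_disc_iff)
      qed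
      have c0: "c t \<ge> 0" using r by (simp add: c_def r_def)
      have "norm (of_real (1 - t) * w\<^sup>2 * deriv (deriv f) (of_real t * w))
         = (1 - t) * (norm w)\<^sup>2 * norm (deriv (deriv f) (of_real t * w))"
        using t by (simp add: norm_mult norm_power del: of_real_diff)
      also have "\<dots> \<le> (2 * r) * (norm w)\<^sup>2 * norm (deriv (deriv f) (of_real t * w))"
        using t w1 mult_left_le[of "norm w" t] by (intro mult_right_mono) (auto simp: r_def)
      also have "\<dots> = c t * (pi * r\<^sup>2) * norm (deriv (deriv f) (of_real t * w))"
      proof -
        have "2 * r = 1 - t * norm w" by (simp add: r_def)
        then have "c t = (norm w)\<^sup>2 * (4 / (pi * (2 * r)))" by (simp only: c_def)
        then show ?thesis using r by (simp add: power2_eq_square)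
      qed
      finally have "ennreal (norm (of_real (1 - t) * w\<^sup>2 * deriv (deriv f) (of_real t * w)))
         \<le> ennreal (c t) * (ennreal (pi * r\<^sup>2) * ennreal (norm (deriv (deriv f) (of_real t * w))))"
        using c0 by (simp add: ennreal_leI mult.assoc flip: ennreal_mult)
      also have "\<dots> \<le> ennreal (c t) * (\<integral>\<^sup>+\<zeta>. indicator (ball (t * w) r) \<zeta> * ennreal (norm (deriv (deriv f) \<zeta>)) \<partial>lborel)"
        by (intro mult_left_mono holomorphic_area_submean holomorphic_on_subset[OF f'' sub] r) simp
      also have "(\<integral>\<^sup>+\<zeta>. indicator (ball (t * w) r) \<zeta> * ennreal (norm (deriv (deriv f) \<zeta>)) \<partial>lborel)
         = (\<integral>\<^sup>+\<zeta>. indicator (ball (t * w) r) \<zeta> * G \<zeta> \<partial>lborel)"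
        using sub by (intro nn_integral_cong) (auto simp: G_def indicator_def)
      also have "ennreal (c t) * \<dots> = (\<integral>\<^sup>+\<zeta>. ennreal (c t) * (indicator (ball (t * w) r) \<zeta> * G \<zeta>) \<partial>lborel)"
        by (intro nn_integral_cmult[symmetric] borel_measurable_times_ennreal borel_measurable_indicator) simp_all
      finally show ?thesis using True by (simp add: r_def)
    qed simp
  qed
  also have "\<dots> = (\<integral>\<^sup>+\<zeta>. (\<integral>\<^sup>+t. indicator {0..1} t * (ennreal (c t) * (indicator (ball (t * w) ((1 - t * norm w) / 2)) \<zeta> * G \<zeta>)) \<partial>lborel) \<partial>lborel)"
    by (rule lborel_pair.Fubini'[OF m])
  also have "\<dots> \<le> (\<integral>\<^sup>+\<zeta>. ennreal (8 / pi) * G \<zeta> \<partial>lborel)"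
  proof (rule nn_integral_mono)
    fix \<zeta>
    have "Measurable.pred borel (\<lambda>t. dist (complex_of_real t * w) \<zeta> < (1 - t * norm w) / 2)"
      by measurable
    then have [measurable]: "(\<lambda>t. indicator (ball (complex_of_real t * w) ((1 - t * norm w) / 2)) \<zeta> :: ennreal) \<in> borel_measurable borel"
      unfolding indicator_def[of "ball _ _"] by simp
    show "(\<integral>\<^sup>+t. indicator {0..1} t * (ennreal (c t) * (indicator (ball (t * w) ((1 - t * norm w) / 2)) \<zeta> * G \<zeta>)) \<partial>lborel)
       \<le> ennreal (8 / pi) * G \<zeta>"
    proof (cases "\<zeta> \<in> disc")
      case True
      have "(\<integral>\<^sup>+t. indicator {0..1} t * (ennreal (c t) * (indicator (ball (t * w) ((1 - t * norm w) / 2)) \<zeta> * G \<zeta>)) \<partial>lborel)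
        = (\<integral>\<^sup>+t. indicator {0..1} t * (ennreal (c t) * indicator (ball (t * w) ((1 - t * norm w) / 2)) \<zeta>) \<partial>lborel) * G \<zeta>"
        by (subst nn_integral_multc[symmetric]) (simp_all add: mult.assoc)
      then show ?thesis
        using radial_kernel_bound[OF w1, of \<zeta>] True
        by (simp add: c_def mem_disc_iff mult_right_mono)
    qed (simp add: G_def)
  qed
  also have "\<dots> = ennreal (8 / pi) * N"
    by (simp add: nn_integral_cmult) (simp add: G_def N_def)
  also have "ennreal (8 / pi) = 8 * ennreal (1 / pi)"
    by (simp add: ennreal_mult'[symmetric] flip: ennreal_numeral)
  finally have main: "ennreal (norm (f w - f 0 - w * deriv f 0)) \<le> 8 * (ennreal (1 / pi) * N)"
    by (simp add: mult.assoc)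
  have "norm (f w) \<le> norm (f 0) + norm (w * deriv f 0) + norm (f w - f 0 - w * deriv f 0)"
    using norm_triangle_ineq[of "f 0 + w * deriv f 0" "f w - f 0 - w * deriv f 0"]
      norm_triangle_ineq[of "f 0" "w * deriv f 0"] by simp
  also have "norm (w * deriv f 0) \<le> norm (deriv f 0)"
    using w1 mult_right_mono[of "norm w" 1 "norm (deriv f 0)"] by (simp add: norm_mult)
  finally have "ennreal (norm (f w)) \<le> ennreal (norm (f 0)) + ennreal (norm (deriv f 0)) + ennreal (norm (f w - f 0 - w * deriv f 0))"
    by (simp add: ennreal_leI flip: ennreal_plus)
  also have "\<dots> \<le> 8 * ennreal (norm (f 0)) + 8 * ennreal (norm (deriv f 0)) + 8 * (ennreal (1 / pi) * N)"
  proof -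
    have le8: "x \<le> 8 * x" for x :: ennreal
      using mult_right_mono[of 1 8 x] by simp
    show ?thesis by (intro add_mono main le8)
  qed
  also have "\<dots> = 8 * B1_norm f" by (simp add: B1_norm_def N_def distrib_left)
  finally show ?thesis .
qed

text \<open>Cauchy's inequality on the disc of radius \<open>r = (1 - norm w) / 2\<close> about
  \<open>w\<close>. The power of 4 arises from
  \<open>(1 - (norm w)\<^sup>2) / 4 \<le> r\<close>.\<close>

lemma in_B1_higher_deriv_bound:
  assumes f: "in_B1 f" and w: "w \<in> disc"
  shows "norm ((deriv ^^ k) f w) \<le> 8 * fact k * 4 ^ k * enn2real (B1_norm f) / (1 - (norm w)\<^sup>2) ^ k"
proof -
  define N where "N = enn2real (B1_norm f)"
  have hol: "f holomorphic_on disc" and N: "B1_norm f = ennreal N" "N \<ge> 0"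
    using f by (auto simp: in_B1_def N_def)
  have w1: "norm w < 1" using w by (simp add: mem_disc_iff)
  define r where "r = (1 - norm w) / 2"
  have r: "r > 0" using w1 by (simp add: r_def)
  have sub: "cball w r \<subseteq> disc"
  proof
    fix z assume "z \<in> cball w r"
    then have "norm z \<le> norm w + r"
      using norm_triangle_ineq2[of z w] by (simp add: dist_norm norm_minus_commute)
    also have "\<dots> < 1" using w1 by (simp add: r_def field_simps)
    finally show "z \<in> disc" by (simp add: mem_disc_iff)
  qed
  have bnd: "norm (f z) \<le> 8 * N" if "z \<in> disc" for z
  proof -
    have "ennreal (norm (f z)) \<le> ennreal (8 * N)"
      using B1_sup_bound[OF hol that] N by (simp add: ennreal_mult')
    then show ?thesis using N by simp
  qed
  have "norm ((deriv ^^ k) f w) \<le> fact k * (8 * N) / r ^ k"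
  proof (rule Cauchy_inequality)
    show "f holomorphic_on ball w r"
      using hol sub ball_subset_cball by (blast intro: holomorphic_on_subset)
    show "continuous_on (cball w r) f"
      by (rule holomorphic_on_imp_continuous_on[OF holomorphic_on_subset[OF hol sub]])
    show "norm (f z) \<le> 8 * N" if "norm (w - z) = r" for z
      using sub that by (intro bnd) (auto simp: dist_norm)
  qed (rule r)
  also have "\<dots> \<le> fact k * (8 * N) / ((1 - (norm w)\<^sup>2) / 4) ^ k"
  proof (intro divide_left_mono power_mono mult_pos_pos zero_less_power)
    have "1 - (norm w)\<^sup>2 = (1 - norm w) * (1 + norm w)" by (simp add: power2_eq_square algebra_simps)
    moreover have "(1 - norm w) * (1 + norm w) \<le> (1 - norm w) * 2" using w1 by (intro mult_left_mono) auto
    ultimately show "(1 - (norm w)\<^sup>2) / 4 \<le> r" by (simp add: r_def)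
    show "0 < (1 - (norm w)\<^sup>2) / 4" using w1 by (simp add: power_less_one_iff abs_square_less_1)
    then show "0 \<le> (1 - (norm w)\<^sup>2) / 4" by simp
  qed (use r N in auto)
  also have "\<dots> = 8 * fact k * 4 ^ k * N / (1 - (norm w)\<^sup>2) ^ k"
    by (simp add: power_divide)
  finally show ?thesis by (simp add: N_def)
qed

section \<open>The test functions\<close>

text \<open>The layer-cake formula \<open>\<bar>z - p\<bar>\<^sup>-\<^sup>3 = \<integral>\<^bsub>s \<ge> \<bar>z - p\<bar>\<^esub> 3 s\<^sup>-\<^sup>4 ds\<close> reduces the estimate to areas of balls.\<close>
lemma nn_integral_inverse_cube_outside_ball:
  fixes p :: complex
  assumes d: "d > 0"
  shows "(\<integral>\<^sup>+z. indicator {z. d \<le> norm (z - p)} z * ennreal (1 / norm (z - p) ^ 3) \<partial>lborel)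
    \<le> ennreal (3 * pi / d)"
proof -
  \<comment> \<open>Used twice: with \<open>m = 3\<close> for the layer-cake formula itself, and
    with \<open>m = 1\<close> for the integral over \<open>s\<close> that remains at the
    end.\<close>
  have tail: "(\<integral>\<^sup>+s. ennreal (c / s ^ Suc m) * indicator {a..} s \<partial>lborel) = ennreal (c / (m * a ^ m))"
    if "a > 0" "c \<ge> 0" "m > 0" for a c :: real and m :: nat
  proof -
    have "(\<integral>\<^sup>+s. ennreal (c / s ^ Suc m) * indicator {a..} s \<partial>lborel) = ennreal (0 - (- c / (m * a ^ m)))"
    proof (rule nn_integral_FTC_atLeast)
      fix s :: real assume s: "a \<le> s"
      show "0 \<le> c / s ^ Suc m" using that s by simp
      have "s ^ (m + m) = s * (s ^ m * s ^ (m - 1))"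
        using that(3) by (cases m) (simp_all flip: power_add power_Suc)
      then show "((\<lambda>s. - c / (m * s ^ m)) has_real_derivative c / s ^ Suc m) (at s)"
        using that s
        by (auto intro!: derivative_eq_intros simp: divide_simps power_add[symmetric])
    next
      show "((\<lambda>s. - c / (real m * s ^ m)) \<longlongrightarrow> 0) at_top"
        using that(3) by (intro tendsto_divide_0[OF tendsto_const] filterlim_at_top_imp_at_infinity
          filterlim_tendsto_pos_mult_at_top[OF tendsto_const] filterlim_pow_at_top filterlim_ident) auto
    qed simp
    then show ?thesis by simp
  qed
  have "(\<integral>\<^sup>+z. indicator {z. d \<le> norm (z - p)} z * ennreal (1 / norm (z - p) ^ 3) \<partial>lborel)
     = (\<integral>\<^sup>+z. (\<integral>\<^sup>+s. indicator {z. d \<le> norm (z - p)} z * (ennreal (3 / s ^ 4) * indicator {norm (z - p)..} s) \<partial>lborel) \<partial>lborel)"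
  proof (rule nn_integral_cong)
    fix z
    show "indicator {z. d \<le> norm (z - p)} z * ennreal (1 / norm (z - p) ^ 3)
      = (\<integral>\<^sup>+s. indicator {z. d \<le> norm (z - p)} z * (ennreal (3 / s ^ 4) * indicator {norm (z - p)..} s) \<partial>lborel)"
    proof (cases "d \<le> norm (z - p)")
      case True
      then have "norm (z - p) > 0" using d by linarith
      from tail[OF this, of 3 3] True show ?thesis by (simp add: eval_nat_numeral)
    qed simp
  qed
  also have "\<dots> = (\<integral>\<^sup>+s. (\<integral>\<^sup>+z. indicator {z. d \<le> norm (z - p)} z * (ennreal (3 / s ^ 4) * indicator {norm (z - p)..} s) \<partial>lborel) \<partial>lborel)"
  proof (rule lborel_pair.Fubini')
    have "Measurable.pred (borel \<Otimes>\<^sub>M borel) (\<lambda>x. norm (snd x - p) \<le> (fst x :: real))" by measurable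
    then show "(\<lambda>(x, y). indicator {z. d \<le> cmod (z - p)} y * (ennreal (3 / x ^ 4) * indicator {cmod (y - p)..} x))
       \<in> borel_measurable (lborel \<Otimes>\<^sub>M lborel)"
      unfolding indicator_def by simp
  qed
  also have "\<dots> \<le> (\<integral>\<^sup>+s. ennreal (3 * pi / s ^ 2) * indicator {d..} s \<partial>lborel)"
  proof (rule nn_integral_mono)
    fix s :: real
    show "(\<integral>\<^sup>+z. indicator {z. d \<le> norm (z - p)} z * (ennreal (3 / s ^ 4) * indicator {norm (z - p)..} s) \<partial>lborel)
      \<le> ennreal (3 * pi / s ^ 2) * indicator {d..} s"
    proof (cases "d \<le> s")
      case True
      \<comment> \<open>For fixed \<open>s\<close> the admissible \<open>z\<close> lie in a disc of
        area \<open>pi * s\<^sup>2\<close>, which lowers the power of \<open>1 / s\<close> from 4 to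
        2.\<close>
      have "(\<integral>\<^sup>+z. indicator {z. d \<le> norm (z - p)} z * (ennreal (3 / s ^ 4) * indicator {norm (z - p)..} s) \<partial>lborel)
         \<le> (\<integral>\<^sup>+z. ennreal (3 / s ^ 4) * indicator (cball p s) z \<partial>lborel)"
        by (intro nn_integral_mono) (auto simp: indicator_def dist_norm norm_minus_commute)
      also have "\<dots> = ennreal (3 / s ^ 4) * ennreal (pi * s\<^sup>2)"
        using True d by (subst nn_integral_cmult_indicator) (simp_all add: emeasure_cball unit_ball_vol_2)
      also have "\<dots> = ennreal (3 * pi / s ^ 2)"
        using True d by (subst ennreal_mult[symmetric]) (simp_all add: divide_simps power2_eq_square eval_nat_numeral)
      finally show ?thesis using True by simp
    next
      case False
      then have "indicator {z. d \<le> norm (z - p)} z * (ennreal (3 / s ^ 4) * indicator {norm (z - p)..} s) = 0" for z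
        by (auto simp: indicator_def)
      then show ?thesis by (simp only:) simp
    qed
  qed
  also have "\<dots> = ennreal (3 * pi / d)"
    using tail[of d "3 * pi" 1] d by (simp add: power2_eq_square)
  finally show ?thesis .
qed

lemma one_minus_cnj_mult_nonzero:
  assumes "a \<in> disc" "z \<in> disc"
  shows "1 - norm a \<le> norm (1 - cnj a * z)" "1 - cnj a * z \<noteq> 0"
proof -
  have "norm (cnj a * z) \<le> norm a"
    using assms mult_left_mono[of "norm z" 1 "norm a"] by (simp add: norm_mult mem_disc_iff)
  then show le: "1 - norm a \<le> norm (1 - cnj a * z)"
    using norm_triangle_ineq2[of 1 "cnj a * z"] by simp
  then show "1 - cnj a * z \<noteq> 0" using assms by (auto simp: mem_disc_iff)
qed

lemma f_test_holomorphic: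
  assumes "a \<in> disc"
  shows "f_test j a holomorphic_on disc"
  unfolding f_test_def using one_minus_cnj_mult_nonzero(2)[OF assms] by (intro holomorphic_intros) auto

text \<open>Each differentiation of a negative power of \<open>1 - cnj a * z\<close> brings down the
  current exponent and \<open>cnj a\<close>. The exponents \<open>j\<close>, \<open>j + 1\<close>,
  ... multiply to a rising factorial.\<close>

lemma f_test_higher_deriv:
  assumes a: "a \<in> disc" and z: "z \<in> disc"
  shows "(deriv ^^ k) (f_test j a) z
    = pochhammer (of_nat j) k * cnj a ^ k * (1 - (of_real (norm a))\<^sup>2) ^ j / (1 - cnj a * z) ^ (j + k)"
  using z
proof (induction k arbitrary: z)
  case 0
  then show ?case by (simp add: f_test_def power_divide)
next
  case (Suc k)
  define C where "C = pochhammer (of_nat j) k * cnj a ^ k * (1 - (complex_of_real (norm a))\<^sup>2) ^ j"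
  define F where "F z = C / (1 - cnj a * z) ^ (j + k)" for z
  have nz: "1 - cnj a * z \<noteq> 0" using one_minus_cnj_mult_nonzero[OF a Suc.prems] by simp
  have "(F has_field_derivative C * (of_nat (j + k) * cnj a) / (1 - cnj a * z) ^ (j + Suc k)) (at z)"
  \<comment> \<open>The power rule is applied in its form for successor exponents; for exponent 0
    the function is constant and the claimed derivative is 0.\<close>
  proof (cases "j + k")
    case 0
    then show ?thesis by (simp add: F_def[abs_def])
  next
    case (Suc m)
    have "((\<lambda>z. 1 - cnj a * z) has_field_derivative - cnj a) (at z)"
      by (auto intro!: derivative_eq_intros)
    from DERIV_divide[OF DERIV_const[of C] DERIV_power_Suc[OF this, of m]] nz
    have "(F has_field_derivative
       - (C * ((1 + of_nat m) * (- cnj a * (1 - cnj a * z) ^ m))) / ((1 - cnj a * z) ^ Suc m * (1 - cnj a * z) ^ Suc m)) (at z)"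
      unfolding F_def Suc by simp
    also have "- (C * ((1 + of_nat m) * (- cnj a * (1 - cnj a * z) ^ m))) / ((1 - cnj a * z) ^ Suc m * (1 - cnj a * z) ^ Suc m)
      = C * (of_nat (j + k) * cnj a) / (1 - cnj a * z) ^ (j + Suc k)"
      unfolding add_Suc_right Suc using nz by simp
    finally show ?thesis .
  qed
  then have "((deriv ^^ k) (f_test j a) has_field_derivative
      C * (of_nat (j + k) * cnj a) / (1 - cnj a * z) ^ (j + Suc k)) (at z)"
    by (rule has_field_derivative_transform_within_open[OF _ open_disc Suc.prems])
       (simp add: F_def C_def Suc.IH)
  then show ?case
    by (simp add: DERIV_imp_deriv C_def pochhammer_Suc algebra_simps)
qed

lemma one_minus_norm_sq_real: "(1 - (complex_of_real (norm a))\<^sup>2) = of_real (1 - (norm a)\<^sup>2)"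
  by simp

text \<open>\<open>p\<close> is the pole of the test function, the mirror image of \<open>a\<close>
  in the unit circle, and \<open>d = norm p - 1\<close> is its distance from the disc. Since
  \<open>1 - cnj a * z = cnj a * (p - z)\<close>, the size of the second derivative is governed by
  the distance to \<open>p\<close>.\<close>

lemma f_test_deriv2_bound:
  assumes a: "a \<in> disc" "a \<noteq> 0" and z: "z \<in> disc" and j: "j \<ge> 1"
  defines "p \<equiv> 1 / cnj a" and "d \<equiv> (1 - norm a) / norm a"
  shows "d \<le> norm (z - p)"
    and "norm (deriv (deriv (f_test j a)) z) \<le> 2 ^ j * (real j * (real j + 1)) * d * (1 / norm (z - p) ^ 3)"
proof -
  define s where "s = norm a"
  define q where "q = norm (1 - cnj a * z)"
  have s: "0 < s" "s < 1" using a by (auto simp: s_def mem_disc_iff)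
  have "1 - cnj a * z = cnj a * (p - z)" using a(2) by (simp add: p_def algebra_simps)
  then have q: "q = s * norm (z - p)" by (simp add: q_def s_def norm_mult norm_minus_commute)
  have q1: "1 - s \<le> q" using one_minus_cnj_mult_nonzero[OF a(1) z] by (simp add: q_def s_def)
  then have q0: "q > 0" using s by simp
  show "d \<le> norm (z - p)" using q1 s unfolding q d_def s_def[symmetric] by (simp add: field_simps)
  have 1: "1 - s\<^sup>2 \<le> 2 * (1 - s)" "0 \<le> 1 - s\<^sup>2"
  proof -
    have "1 - s\<^sup>2 = (1 + s) * (1 - s)" by (simp add: power2_eq_square algebra_simps)
    moreover have "(1 + s) * (1 - s) \<le> 2 * (1 - s)" using s by (intro mult_right_mono) auto
    moreover have "0 \<le> (1 + s) * (1 - s)" using s by simp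
    ultimately show "1 - s\<^sup>2 \<le> 2 * (1 - s)" "0 \<le> 1 - s\<^sup>2" by auto
  qed
  have "norm (deriv (deriv (f_test j a)) z) = norm ((deriv ^^ 2) (f_test j a) z)"
    by (simp add: numeral_2_eq_2)
  also have "\<dots> = norm (of_nat (j * (j + 1)) * (cnj a)\<^sup>2 * of_real (1 - s\<^sup>2) ^ j / (1 - cnj a * z) ^ (j + 2))"
    unfolding f_test_higher_deriv[OF a(1) z] one_minus_norm_sq_real s_def
    by (simp add: numeral_2_eq_2 pochhammer_Suc algebra_simps)
  also have "\<dots> = real (j * (j + 1)) * s\<^sup>2 * (1 - s\<^sup>2) ^ j / q ^ (j + 2)"
    using 1(2) by (simp only: abs_of_nonneg norm_divide norm_mult norm_power norm_of_nat norm_of_real complex_mod_cnj s_def[symmetric] q_def[symmetric])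
  \<comment> \<open>All but one of the \<open>j\<close> factors \<open>1 - s\<close> are traded for
    \<open>q\<close>, which is at least as large. This reduces the exponent of \<open>q\<close> to 3
    for every \<open>j\<close>; the factor kept becomes \<open>d\<close>.\<close>
  also have "\<dots> \<le> real (j * (j + 1)) * s\<^sup>2 * (2 ^ j * (1 - s) * q ^ (j - 1)) / q ^ (j + 2)"
  proof (intro divide_right_mono mult_left_mono)
    have "(1 - s\<^sup>2) ^ j \<le> (2 * (1 - s)) ^ j" using 1 by (intro power_mono)
    also have "\<dots> = 2 ^ j * ((1 - s) * (1 - s) ^ (j - 1))"
      unfolding power_mult_distrib using j by (cases j) simp_all
    also have "\<dots> \<le> 2 ^ j * ((1 - s) * q ^ (j - 1))"
      using s q1 by (intro mult_left_mono power_mono) auto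
    finally show "(1 - s\<^sup>2) ^ j \<le> 2 ^ j * (1 - s) * q ^ (j - 1)" by (simp add: mult.assoc)
  qed (use q0 in auto)
  also have "\<dots> = real (j * (j + 1)) * s\<^sup>2 * (2 ^ j * (1 - s)) / q ^ 3"
  proof -
    have "q ^ (j + 2) = q ^ (j - 1) * q ^ 3" using j by (simp flip: power_add)
    then show ?thesis using q0 by simp
  qed
  also have "\<dots> = 2 ^ j * (real j * (real j + 1)) * d * (1 / norm (z - p) ^ 3)"
    using s q0 unfolding q d_def s_def[symmetric]
    by (simp add: divide_simps power_mult_distrib power2_eq_square power3_eq_cube zero_less_mult_iff algebra_simps)
  finally show "norm (deriv (deriv (f_test j a)) z) \<le> 2 ^ j * (real j * (real j + 1)) * d * (1 / norm (z - p) ^ 3)" .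
qed

text \<open>The bound is uniform in \<open>a\<close> because the factor \<open>d\<close> of the
  pointwise estimate cancels the \<open>1 / d\<close> from the integral of the inverse cube. At
  \<open>a = 0\<close> there is no pole, and the test function is constant.\<close>

lemma B1_norm_f_test_bound:
  assumes a: "a \<in> disc" and j: "j \<ge> 1"
  shows "B1_norm (f_test j a) \<le> ennreal (1 + j + 3 * (2 ^ j * (real j * (real j + 1))))"
proof -
  define K where "K = 2 ^ j * (real j * (real j + 1))"
  have K: "K \<ge> 0" by (simp add: K_def)
  have 0: "0 \<in> disc" by (simp add: mem_disc_iff)
  have a1: "norm a < 1" using a by (simp add: mem_disc_iff)
  have s: "0 \<le> 1 - (norm a)\<^sup>2" "1 - (norm a)\<^sup>2 \<le> 1"
    using power_le_one[of "norm a" 2] a1 by simp_all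
  have "norm (of_real (1 - (norm a)\<^sup>2) ^ j :: complex) = (1 - (norm a)\<^sup>2) ^ j"
    using s(1) by (simp only: norm_power norm_of_real abs_of_nonneg)
  then have np: "norm (of_real (1 - (norm a)\<^sup>2) ^ j :: complex) \<le> 1"
    using power_le_one[OF s] by simp
  have v0: "norm (f_test j a 0) \<le> 1"
    using f_test_higher_deriv[OF a 0, of 0 j] np unfolding one_minus_norm_sq_real by (simp del: of_real_diff)
  have "deriv (f_test j a) 0 = of_nat j * cnj a * of_real (1 - (norm a)\<^sup>2) ^ j"
    using f_test_higher_deriv[OF a 0, of 1 j] unfolding one_minus_norm_sq_real by (simp del: of_real_diff)
  then have "norm (deriv (f_test j a) 0) = real j * (norm a * norm (of_real (1 - (norm a)\<^sup>2) ^ j :: complex))"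
    by (simp only: norm_mult complex_mod_cnj norm_of_nat mult.assoc)
  also have "\<dots> \<le> real j * (1 * 1)"
    using np a1 by (intro mult_left_mono mult_mono) auto
  finally have v1: "norm (deriv (f_test j a) 0) \<le> j" by simp
  have int: "(\<integral>\<^sup>+ z. indicator disc z * ennreal (norm (deriv (deriv (f_test j a)) z)) \<partial>lborel) \<le> ennreal (3 * pi * K)"
  proof (cases "a = 0")
    case True
    have "norm (deriv (deriv (f_test j a)) z) = 0" if "z \<in> disc" for z
      using f_test_higher_deriv[OF a that, of 2 j] True by (simp add: numeral_2_eq_2)
    then have "indicator disc z * ennreal (norm (deriv (deriv (f_test j a)) z)) = 0" for z
      by (auto simp: indicator_def)
    then have "(\<integral>\<^sup>+ z. indicator disc z * ennreal (norm (deriv (deriv (f_test j a)) z)) \<partial>lborel) = (\<integral>\<^sup>+ z. 0 \<partial>(lborel::complex measure))"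
      by (simp only:)
    then show ?thesis by simp
  next
    case False
    define p where "p = 1 / cnj a"
    define d where "d = (1 - norm a) / norm a"
    have d: "d > 0" using False a1 by (simp add: d_def)
    note b = f_test_deriv2_bound[OF a False _ j, folded p_def d_def K_def]
    have "(\<integral>\<^sup>+ z. indicator disc z * ennreal (norm (deriv (deriv (f_test j a)) z)) \<partial>lborel)
      \<le> (\<integral>\<^sup>+ z. ennreal (K * d) * (indicator {z. d \<le> norm (z - p)} z * ennreal (1 / norm (z - p) ^ 3)) \<partial>lborel)"
    proof (rule nn_integral_mono)
      fix z
      show "indicator disc z * ennreal (norm (deriv (deriv (f_test j a)) z))
        \<le> ennreal (K * d) * (indicator {z. d \<le> norm (z - p)} z * ennreal (1 / norm (z - p) ^ 3))"
        using b[of z] K d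
        by (cases "z \<in> disc") (simp_all add: ennreal_leI flip: ennreal_mult)
    qed
    also have "\<dots> = ennreal (K * d) * (\<integral>\<^sup>+ z. (indicator {z. d \<le> norm (z - p)} z * ennreal (1 / norm (z - p) ^ 3)) \<partial>lborel)"
      by (rule nn_integral_cmult) measurable
    also have "\<dots> \<le> ennreal (K * d) * ennreal (3 * pi / d)"
      by (intro mult_left_mono nn_integral_inverse_cube_outside_ball d) simp
    also have "\<dots> = ennreal (3 * pi * K)"
      using d K by (subst ennreal_mult[symmetric]) (simp_all add: field_simps)
    finally show ?thesis .
  qed
  have "B1_norm (f_test j a) \<le> ennreal 1 + ennreal j + ennreal (1 / pi) * ennreal (3 * pi * K)"
    unfolding B1_norm_def by (intro add_mono mult_left_mono ennreal_leI v0 v1 int) simp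
  also have "ennreal (1 / pi) * ennreal (3 * pi * K) = ennreal (3 * K)"
    using K by (subst ennreal_mult[symmetric]) (simp_all add: field_simps)
  also have "ennreal 1 + ennreal j + ennreal (3 * K) = ennreal (1 + j + 3 * K)"
    using K by (simp flip: ennreal_plus add: ennreal_1[symmetric] del: ennreal_1)
  finally show ?thesis by (simp add: K_def)
qed

lemma f_test_in_B1:
  assumes a: "a \<in> disc" and j: "j \<ge> 1"
  shows "in_B1 (f_test j a)"
  using B1_norm_f_test_bound[OF assms] f_test_holomorphic[OF a]
  by (auto simp: in_B1_def intro: le_less_trans)

lemma power_in_B1: "in_B1 (\<lambda>z. z ^ m)"
proof -
  let ?f = "\<lambda>z::complex. z ^ m"
  \<comment> \<open>For \<open>m < 2\<close> the truncated difference \<open>Suc m - 2\<close> is 0,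
    so the rising factorial vanishes, as the second derivative does.\<close>
  have d2: "deriv (deriv ?f) z = pochhammer (of_nat (Suc m - 2)) 2 * z ^ (m - 2)" for z
    using higher_deriv_power[of 2 0 m z] by (simp add: numeral_2_eq_2)
  define K where "K = norm (pochhammer (of_nat (Suc m - 2)) 2 :: complex)"
  have "(\<integral>\<^sup>+ z. indicator disc z * ennreal (norm (deriv (deriv ?f) z)) \<partial>lborel)
     \<le> (\<integral>\<^sup>+ z. ennreal K * indicator disc z \<partial>lborel)"
  proof (rule nn_integral_mono)
    fix z
    show "indicator disc z * ennreal (norm (deriv (deriv ?f) z)) \<le> ennreal K * indicator disc z"
      using power_le_one[of "norm z" "m - 2"]
      by (auto simp: indicator_def d2 norm_mult norm_power mem_disc_iff K_def intro!: ennreal_leI mult_left_le)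
  qed
  also have "\<dots> = ennreal K * emeasure lborel disc"
    by (rule nn_integral_cmult_indicator) (simp add: disc_def)
  also have "\<dots> < \<infinity>"
    using emeasure_lborel_ball_finite[of "0::complex" 1] by (simp add: disc_def ennreal_mult_less_top)
  finally show ?thesis
    by (auto simp: in_B1_def B1_norm_def ennreal_mult_less_top intro!: holomorphic_intros)
qed

section \<open>The operator\<close>

text \<open>Passing to differences in \<open>j\<close> lowers the number of unknowns by one.\<close>
lemma pochhammer_system_bound:
  "\<exists>C. \<forall>(X :: nat \<Rightarrow> complex) M. (\<forall>j\<in>{m..m+n}. norm (\<Sum>k\<le>n. pochhammer (of_nat j) k * X k) \<le> M)
      \<longrightarrow> (\<forall>k\<le>n. norm (X k) \<le> C * M)"
proof (induction n arbitrary: m)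
  case 0
  show ?case by (rule exI[of _ 1]) auto
next
  case (Suc n)
  obtain C where C: "\<And>(X :: nat \<Rightarrow> complex) M. (\<forall>j\<in>{Suc m..Suc m+n}. norm (\<Sum>k\<le>n. pochhammer (of_nat j) k * X k) \<le> M)
      \<Longrightarrow> (\<forall>k\<le>n. norm (X k) \<le> C * M)"
    using Suc.IH[of "Suc m"] by metis
  \<comment> \<open>Once the later unknowns are bounded, \<open>X 0\<close> is recovered from the
    equation for \<open>j = m\<close>; \<open>S * M\<close> bounds the remaining terms of that
    equation.\<close>
  define S where "S = (\<Sum>k\<le>n. norm (pochhammer (of_nat m) (Suc k) :: complex) * (2 * \<bar>C\<bar>))"
  have S: "S \<ge> 0" by (auto simp: S_def intro!: sum_nonneg)
  show ?case
  proof (intro exI[of _ "1 + S + 2 * \<bar>C\<bar>"] allI impI)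
    fix X :: "nat \<Rightarrow> complex" and M k
    define Y where "Y j = (\<Sum>k\<le>Suc n. pochhammer (of_nat j) k * X k)" for j
    assume "\<forall>j\<in>{m..m + Suc n}. norm (\<Sum>k\<le>Suc n. pochhammer (of_nat j) k * X k) \<le> M"
    then have Y: "norm (Y j) \<le> M" if "j \<in> {m..m + Suc n}" for j using that by (auto simp: Y_def)
    have M: "M \<ge> 0" using Y[of m] by (auto intro: order_trans[OF norm_ge_zero])
    assume k: "k \<le> Suc n"
    have Y_split: "Y j = X 0 + (\<Sum>k\<le>n. pochhammer (of_nat j) (Suc k) * X (Suc k))" for j
      unfolding Y_def by (subst sum.atMost_Suc_shift) simp
    \<comment> \<open>By this identity, differences of neighbouring equations form a system of the
      same shape in the unknowns \<open>of_nat (Suc k) * X (Suc k)\<close>, with first index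
      \<open>Suc m\<close> and bound \<open>2 * M\<close>.\<close>
    have poch: "pochhammer (of_nat (Suc j)) (Suc k) - pochhammer (of_nat j) (Suc k)
        = (pochhammer (of_nat (Suc j)) k * of_nat (Suc k) :: complex)" for j k
      unfolding pochhammer_Suc[of "of_nat (Suc j)"] pochhammer_rec[of "of_nat j"]
      by (simp add: algebra_simps)
    have "\<forall>j\<in>{Suc m..Suc m+n}. norm (\<Sum>k\<le>n. pochhammer (of_nat j) k * (of_nat (Suc k) * X (Suc k))) \<le> 2 * M"
    proof
      fix j assume j: "j \<in> {Suc m..Suc m+n}"
      then obtain i where i: "j = Suc i" by (cases j) auto
      have "Y j - Y i = (\<Sum>k\<le>n. (pochhammer (of_nat (Suc i)) (Suc k) - pochhammer (of_nat i) (Suc k)) * X (Suc k))"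
        by (simp only: Y_split i sum_subtractf left_diff_distrib) simp
      also have "\<dots> = (\<Sum>k\<le>n. pochhammer (of_nat j) k * (of_nat (Suc k) * X (Suc k)))"
        unfolding poch i by (simp only: mult.assoc)
      finally have "(\<Sum>k\<le>n. pochhammer (of_nat j) k * (of_nat (Suc k) * X (Suc k))) = Y j - Y i" ..
      then show "norm (\<Sum>k\<le>n. pochhammer (of_nat j) k * (of_nat (Suc k) * X (Suc k))) \<le> 2 * M"
        using norm_triangle_ineq4[of "Y j" "Y i"] Y[of j] Y[of i] j i by auto
    qed
    from C[OF this] have "\<forall>k\<le>n. norm (of_nat (Suc k) * X (Suc k)) \<le> C * (2 * M)" .
    then have X_Suc: "norm (X (Suc k)) \<le> 2 * \<bar>C\<bar> * M" if "k \<le> n" for k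
    proof -
      have "norm (X (Suc k)) \<le> norm (of_nat (Suc k) :: complex) * norm (X (Suc k))"
        unfolding norm_of_nat by (rule mult_le_cancel_right1[THEN iffD2]) simp
      also have "\<dots> \<le> C * (2 * M)" using \<open>\<forall>k\<le>n. _\<close> that by (simp only: norm_mult)
      also have "\<dots> \<le> \<bar>C\<bar> * (2 * M)" using M by (intro mult_right_mono) auto
      finally show ?thesis by simp
    qed
    show "norm (X k) \<le> (1 + S + 2 * \<bar>C\<bar>) * M"
    proof (cases k)
      case 0
      have "X 0 = Y m - (\<Sum>k\<le>n. pochhammer (of_nat m) (Suc k) * X (Suc k))" by (simp add: Y_split)
      then have "norm (X 0) \<le> norm (Y m) + norm (\<Sum>k\<le>n. pochhammer (of_nat m) (Suc k) * X (Suc k))"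
        using norm_triangle_ineq4 by metis
      also have "norm (\<Sum>k\<le>n. pochhammer (of_nat m) (Suc k) * X (Suc k))
          \<le> (\<Sum>k\<le>n. norm (pochhammer (of_nat m) (Suc k) :: complex) * (2 * \<bar>C\<bar> * M))"
        by (intro sum_norm_le) (auto simp only: norm_mult intro!: mult_left_mono X_Suc norm_ge_zero)
      also have "\<dots> = S * M" by (simp only: S_def sum_distrib_right mult.assoc)
      finally show ?thesis using 0 Y[of m] M by (simp add: algebra_simps) (smt (verit) mult_nonneg_nonneg abs_ge_zero)
    next
      case (Suc i)
      then show ?thesis using X_Suc[of i] k M S
        by (simp add: algebra_simps) (smt (verit) mult_nonneg_nonneg)
    qed
  qed
qed

section \<open>Boundedness against the weight\<close>

text \<open>The suprema of the theorem in terms of real bounds, where sums and multiples are easier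
  to handle than in \<open>ennreal\<close>.\<close>

definition weighted_bdd :: "real \<Rightarrow> (complex \<Rightarrow> real) \<Rightarrow> bool" where
  "weighted_bdd \<alpha> g \<longleftrightarrow> (\<exists>M. \<forall>z\<in>disc. (1 - (norm z)\<^sup>2) powr \<alpha> * g z \<le> M)"

lemma SUP_ennreal_finite_iff:
  "(SUP z\<in>A. ennreal (g z)) < \<infinity> \<longleftrightarrow> (\<exists>M. \<forall>z\<in>A. g z \<le> M)"
proof
  assume f: "(SUP z\<in>A. ennreal (g z)) < \<infinity>"
  show "\<exists>M. \<forall>z\<in>A. g z \<le> M"
  proof (intro exI ballI)
    fix z assume "z \<in> A"
    then have "ennreal (g z) \<le> ennreal (enn2real (SUP z\<in>A. ennreal (g z)))"
      using f by (auto intro: SUP_upper)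
    then show "g z \<le> enn2real (SUP z\<in>A. ennreal (g z))"
      by (subst (asm) ennreal_le_iff) auto
  qed
next
  assume "\<exists>M. \<forall>z\<in>A. g z \<le> M"
  then obtain M where "\<forall>z\<in>A. g z \<le> M" ..
  then have "(SUP z\<in>A. ennreal (g z)) \<le> ennreal M" by (auto intro!: SUP_least ennreal_leI)
  then show "(SUP z\<in>A. ennreal (g z)) < \<infinity>" by (rule le_less_trans) simp
qed

lemma SUP_weighted_finite_iff:
  "(SUP z\<in>disc. ennreal ((1 - (norm z)\<^sup>2) powr \<alpha> * g z)) < \<infinity> \<longleftrightarrow> weighted_bdd \<alpha> g"
  unfolding weighted_bdd_def by (rule SUP_ennreal_finite_iff)

lemma weighted_bdd_mono:
  assumes "weighted_bdd \<alpha> h" "\<And>z. z \<in> disc \<Longrightarrow> g z \<le> h z"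
  shows "weighted_bdd \<alpha> g"
  using assms unfolding weighted_bdd_def
  by (meson mult_left_mono order_trans powr_ge_zero)

lemma weighted_bdd_cmult:
  assumes "weighted_bdd \<alpha> g" "c \<ge> 0"
  shows "weighted_bdd \<alpha> (\<lambda>z. c * g z)"
proof -
  obtain M where "\<And>z. z \<in> disc \<Longrightarrow> (1 - (norm z)\<^sup>2) powr \<alpha> * g z \<le> M"
    using assms unfolding weighted_bdd_def by auto
  then have "\<forall>z\<in>disc. (1 - (norm z)\<^sup>2) powr \<alpha> * (c * g z) \<le> c * M"
    using assms(2) by (auto simp: mult.left_commute intro: mult_left_mono)
  then show ?thesis unfolding weighted_bdd_def ..
qed

lemma weighted_bdd_add:
  assumes "weighted_bdd \<alpha> g" "weighted_bdd \<alpha> h"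
  shows "weighted_bdd \<alpha> (\<lambda>z. g z + h z)"
  using assms unfolding weighted_bdd_def by (metis add_mono distrib_left)

text \<open>Nonnegative summands lie below their sum. This splits the conditions of the theorem into
  one for each coefficient.\<close>

lemma weighted_bdd_add_iff:
  assumes "\<And>z. z \<in> disc \<Longrightarrow> 0 \<le> g z" "\<And>z. z \<in> disc \<Longrightarrow> 0 \<le> h z"
  shows "weighted_bdd \<alpha> (\<lambda>z. g z + h z) \<longleftrightarrow> weighted_bdd \<alpha> g \<and> weighted_bdd \<alpha> h"
  using assms
  by (auto intro: weighted_bdd_add weighted_bdd_mono[where h = "\<lambda>z. g z + h z"])

lemma weighted_bdd_sum:
  assumes "finite I" "\<And>i. i \<in> I \<Longrightarrow> weighted_bdd \<alpha> (g i)"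
  shows "weighted_bdd \<alpha> (\<lambda>z. \<Sum>i\<in>I. g i z)"
  using assms
proof (induction I rule: finite_induct)
  case empty
  show ?case unfolding weighted_bdd_def by (auto intro: exI[of _ 0])
qed (simp add: weighted_bdd_add)

section \<open>The second derivative of the operator\<close>

text \<open>Indexing by the order of the derivative of \<open>f\<close> allows sums over
  \<open>k \<le> 4\<close>. The part with \<open>u\<close> contributes to orders 0 to 2 and the part
  with \<open>v\<close> to orders 2 to 4, so they meet at order 2.\<close>

definition T2_coeff :: "(complex \<Rightarrow> complex) \<Rightarrow> (complex \<Rightarrow> complex) \<Rightarrow> (complex \<Rightarrow> complex) \<Rightarrow> nat \<Rightarrow> complex \<Rightarrow> complex" where
  "T2_coeff u v \<phi> k z =
    [deriv (deriv u) z, 2 * deriv u z * deriv \<phi> z + u z * deriv (deriv \<phi>) z,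
     u z * (deriv \<phi> z)\<^sup>2 + deriv (deriv v) z,
     2 * deriv v z * deriv \<phi> z + v z * deriv (deriv \<phi>) z, v z * (deriv \<phi> z)\<^sup>2] ! k"

lemma deriv_mult_compose:
  assumes hol: "u holomorphic_on disc" "g holomorphic_on disc" "\<phi> holomorphic_on disc"
    and "\<phi> ` disc \<subseteq> disc" and z: "z \<in> disc"
  shows "((\<lambda>z. u z * g (\<phi> z)) has_field_derivative
      deriv u z * g (\<phi> z) + u z * deriv \<phi> z * deriv g (\<phi> z)) (at z)"
proof -
  have "\<phi> z \<in> disc" using assms by auto
  then have D: "(u has_field_derivative deriv u z) (at z)" "(\<phi> has_field_derivative deriv \<phi> z) (at z)"
    "(g has_field_derivative deriv g (\<phi> z)) (at (\<phi> z))"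
    using hol z by (auto intro: holomorphic_derivI[OF _ open_disc])
  show ?thesis
    by (rule derivative_eq_intros D DERIV_chain2[where f = g] | simp add: algebra_simps)+
qed

text \<open>The first derivative is a sum of two products of the original shape, with weights
  \<open>deriv u\<close> and \<open>u * deriv \<phi>\<close>, so the first-order rule applies to
  each. It will serve for the weight \<open>u\<close> with \<open>g = f\<close> and for the weight
  \<open>v\<close> with \<open>g = f''\<close>.\<close>

lemma deriv2_mult_compose:
  assumes hol: "u holomorphic_on disc" "g holomorphic_on disc" "\<phi> holomorphic_on disc"
    and sub: "\<phi> ` disc \<subseteq> disc" and z: "z \<in> disc"
  shows "(deriv (\<lambda>z. u z * g (\<phi> z)) has_field_derivative
      deriv (deriv u) z * g (\<phi> z) + (2 * deriv u z * deriv \<phi> z + u z * deriv (deriv \<phi>) z) * deriv g (\<phi> z)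
       + u z * (deriv \<phi> z)\<^sup>2 * deriv (deriv g) (\<phi> z)) (at z)"
proof (rule has_field_derivative_transform_within_open[OF _ open_disc z])
  have hol': "deriv u holomorphic_on disc" "deriv g holomorphic_on disc" "deriv \<phi> holomorphic_on disc"
    using hol by (simp_all add: holomorphic_deriv)
  have "(\<lambda>z. u z * deriv \<phi> z) holomorphic_on disc" using hol hol' by (simp add: holomorphic_on_mult)
  note D = deriv_mult_compose[OF hol'(1) hol(2,3) sub z] deriv_mult_compose[OF this hol'(2) hol(3) sub z]
  have "((\<lambda>z. u z * deriv \<phi> z) has_field_derivative deriv u z * deriv \<phi> z + u z * deriv (deriv \<phi>) z) (at z)"
    using hol hol' z by (auto intro!: derivative_eq_intros holomorphic_derivI[OF _ open_disc] simp: algebra_simps)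
  note P = DERIV_imp_deriv[OF this]
  show "((\<lambda>z. deriv u z * g (\<phi> z) + u z * deriv \<phi> z * deriv g (\<phi> z)) has_field_derivative
      deriv (deriv u) z * g (\<phi> z) + (2 * deriv u z * deriv \<phi> z + u z * deriv (deriv \<phi>) z) * deriv g (\<phi> z)
       + u z * (deriv \<phi> z)\<^sup>2 * deriv (deriv g) (\<phi> z)) (at z)"
    using DERIV_add[OF D] by (simp add: P algebra_simps power2_eq_square)
  show "deriv u w * g (\<phi> w) + u w * deriv \<phi> w * deriv g (\<phi> w) = deriv (\<lambda>z. u z * g (\<phi> z)) w" if "w \<in> disc" for w
    using deriv_mult_compose[OF hol sub that] by (simp add: DERIV_imp_deriv)
qed

lemma sum_atMost_4: "(\<Sum>k\<le>(4::nat). f k) = f 0 + f 1 + f 2 + f 3 + (f 4 :: 'a::comm_monoid_add)"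
  by (simp add: eval_nat_numeral)

context
  fixes \<alpha> :: real and u v \<phi> :: "complex \<Rightarrow> complex"
  assumes u: "u holomorphic_on disc" and v: "v holomorphic_on disc"
    and \<phi>: "\<phi> holomorphic_on disc" and \<phi>_disc: "\<phi> ` disc \<subseteq> disc"
begin

private abbreviation "A \<equiv> T2_coeff u v \<phi>"

private lemma T2_deriv:
  assumes f: "f holomorphic_on disc"
  shows "T2 u v \<phi> f holomorphic_on disc" (is ?hol)
    and "z \<in> disc \<Longrightarrow> deriv (T2 u v \<phi> f) z = deriv u z * f (\<phi> z) + u z * deriv \<phi> z * deriv f (\<phi> z)
        + deriv v z * (deriv ^^ 2) f (\<phi> z) + v z * deriv \<phi> z * (deriv ^^ 3) f (\<phi> z)"
    and "z \<in> disc \<Longrightarrow> deriv (deriv (T2 u v \<phi> f)) z = (\<Sum>k\<le>4. A k z * (deriv ^^ k) f (\<phi> z))"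
proof -
  have f'': "deriv (deriv f) holomorphic_on disc" using f by (simp add: holomorphic_deriv)
  let ?P = "\<lambda>z. u z * f (\<phi> z)" and ?Q = "\<lambda>z. v z * deriv (deriv f) (\<phi> z)"
  have T: "T2 u v \<phi> f = (\<lambda>z. ?P z + ?Q z)" by (simp add: T2_def fun_eq_iff)
  note D1 = DERIV_add[OF deriv_mult_compose[OF u f \<phi> \<phi>_disc] deriv_mult_compose[OF v f'' \<phi> \<phi>_disc], folded T]
  note D2 = DERIV_add[OF deriv2_mult_compose[OF u f \<phi> \<phi>_disc] deriv2_mult_compose[OF v f'' \<phi> \<phi>_disc]]
  show ?hol using D1 by (auto simp: holomorphic_on_open)
  show "deriv (T2 u v \<phi> f) z = deriv u z * f (\<phi> z) + u z * deriv \<phi> z * deriv f (\<phi> z)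
        + deriv v z * (deriv ^^ 2) f (\<phi> z) + v z * deriv \<phi> z * (deriv ^^ 3) f (\<phi> z)" if "z \<in> disc"
    using DERIV_imp_deriv[OF D1[OF that that]] by (simp add: eval_nat_numeral add.assoc)
  assume z: "z \<in> disc"
  \<comment> \<open>The first derivatives agree on the whole open disc, hence they may be
    differentiated once more.\<close>
  have eq: "deriv ?P w + deriv ?Q w = deriv (T2 u v \<phi> f) w" if w: "w \<in> disc" for w
    using DERIV_imp_deriv[OF D1[OF w w]] DERIV_imp_deriv[OF deriv_mult_compose[OF u f \<phi> \<phi>_disc w]]
      DERIV_imp_deriv[OF deriv_mult_compose[OF v f'' \<phi> \<phi>_disc w]] by simp
  from DERIV_imp_deriv[OF has_field_derivative_transform_within_open[OF D2[OF z z] open_disc z eq]]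
  show "deriv (deriv (T2 u v \<phi> f)) z = (\<Sum>k\<le>4. A k z * (deriv ^^ k) f (\<phi> z))"
    unfolding sum_atMost_4 by (simp add: T2_coeff_def eval_nat_numeral algebra_simps)
qed

section \<open>Necessity of the conditions\<close>

private lemma weighted_bdd_T2_deriv2:
  assumes "f holomorphic_on disc" "Z_norm \<alpha> (T2 u v \<phi> f) < \<infinity>"
  shows "weighted_bdd \<alpha> (\<lambda>z. norm (\<Sum>k\<le>4. A k z * (deriv ^^ k) f (\<phi> z)))"
proof -
  have "weighted_bdd \<alpha> (\<lambda>z. norm (deriv (deriv (T2 u v \<phi> f)) z))"
    using assms(2) unfolding Z_norm_def SUP_weighted_finite_iff[symmetric] by simp
  then show ?thesis by (rule weighted_bdd_mono) (simp add: T2_deriv(3)[OF assms(1)])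
qed

private lemma T2_bounded_imp_Z_norm_finite:
  assumes "T2_bounded \<alpha> u v \<phi>" "in_B1 f"
  shows "Z_norm \<alpha> (T2 u v \<phi> f) < \<infinity>"
proof -
  obtain C where "Z_norm \<alpha> (T2 u v \<phi> f) \<le> ennreal C * B1_norm f"
    using assms unfolding T2_bounded_def by auto
  also have "\<dots> < \<infinity>" using assms(2) by (simp add: in_B1_def ennreal_mult_less_top)
  finally show ?thesis .
qed

text \<open>For the monomial of degree \<open>m\<close>, derivatives of order above \<open>m\<close>
  vanish and the one of order \<open>m\<close> is \<open>fact m\<close>. Those of lower order are
  bounded on the disc and meet coefficients already controlled by induction.\<close>

private lemma T2_bounded_imp_weighted_bdd_coeff:
  assumes T: "T2_bounded \<alpha> u v \<phi>"
  shows "m \<le> 4 \<Longrightarrow> weighted_bdd \<alpha> (\<lambda>z. norm (A m z))"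
proof (induction m rule: less_induct)
  case (less m)
  let ?p = "\<lambda>k. pochhammer (of_nat (Suc m - k)) k :: complex"
  let ?S = "\<lambda>z. \<Sum>k\<le>4. A k z * (?p k * \<phi> z ^ (m - k))"
  have "(deriv ^^ k) (\<lambda>z. z ^ m) w = ?p k * w ^ (m - k)" for k w
    using higher_deriv_power[of k 0 m w] by simp
  moreover have "weighted_bdd \<alpha> (\<lambda>z. norm (\<Sum>k\<le>4. A k z * (deriv ^^ k) (\<lambda>z. z ^ m) (\<phi> z)))"
    by (rule weighted_bdd_T2_deriv2[OF _ T2_bounded_imp_Z_norm_finite[OF T power_in_B1]])
       (intro holomorphic_intros)
  ultimately have S: "weighted_bdd \<alpha> (\<lambda>z. norm (?S z))"
    by (simp only:)
  have "weighted_bdd \<alpha> (\<lambda>z. norm (?S z) + (\<Sum>k<m. norm (?p k) * norm (A k z)))"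
    using less by (intro weighted_bdd_add S weighted_bdd_sum weighted_bdd_cmult) auto
  then show ?case
  proof (rule weighted_bdd_mono)
    fix z assume "z \<in> disc"
    then have "\<phi> z \<in> disc" using \<phi>_disc by auto
    then have \<phi>1: "norm (\<phi> z) \<le> 1" by (simp add: mem_disc_iff)
    \<comment> \<open>For \<open>k > m\<close> the truncated difference \<open>Suc m - k\<close> is
      0, so \<open>?p k\<close> vanishes.\<close>
    have "?S z = (\<Sum>k\<le>m. A k z * (?p k * \<phi> z ^ (m - k)))"
      using less.prems by (intro sum.mono_neutral_right) (auto simp: pochhammer_0_left)
    also have "\<dots> = (\<Sum>k<m. A k z * (?p k * \<phi> z ^ (m - k))) + A m z * fact m"
      by (simp add: lessThan_Suc_atMost[symmetric] pochhammer_fact)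
    finally have "A m z * fact m = ?S z - (\<Sum>k<m. A k z * (?p k * \<phi> z ^ (m - k)))"
      by simp
    then have "norm (A m z * fact m) \<le> norm (?S z) + norm (\<Sum>k<m. A k z * (?p k * \<phi> z ^ (m - k)))"
      by (simp only: norm_triangle_ineq4)
    also have "norm (\<Sum>k<m. A k z * (?p k * \<phi> z ^ (m - k))) \<le> (\<Sum>k<m. norm (?p k) * norm (A k z))"
    proof (rule sum_norm_le)
      fix k
      have "norm (A k z * (?p k * \<phi> z ^ (m - k))) = norm (?p k) * norm (A k z) * norm (\<phi> z) ^ (m - k)"
        by (simp only: norm_mult norm_power mult_ac)
      also have "\<dots> \<le> norm (?p k) * norm (A k z) * 1"
        using \<phi>1 by (intro mult_left_mono power_le_one) auto
      finally show "norm (A k z * (?p k * \<phi> z ^ (m - k))) \<le> norm (?p k) * norm (A k z)" by simp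
    qed
    also have "norm (A m z) \<le> norm (A m z * fact m)"
      using fact_ge_1[of m, where ?'a = real] mult_left_mono[of 1 "fact m" "norm (A m z)"]
      by (simp add: norm_mult)
    finally show "norm (A m z) \<le> norm (?S z) + (\<Sum>k<m. norm (?p k) * norm (A k z))" by simp
  qed
qed

private lemma T2_bounded_imp_f_test_bounded:
  assumes T: "T2_bounded \<alpha> u v \<phi>" and j: "j \<ge> 1"
  shows "(SUP a\<in>disc. Z_norm \<alpha> (T2 u v \<phi> (f_test j a))) < \<infinity>"
proof -
  obtain C where C: "\<And>f. in_B1 f \<Longrightarrow> Z_norm \<alpha> (T2 u v \<phi> f) \<le> ennreal C * B1_norm f"
    using T unfolding T2_bounded_def by auto
  define K where "K = 1 + j + 3 * (2 ^ j * (real j * (real j + 1)))"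
  have "(SUP a\<in>disc. Z_norm \<alpha> (T2 u v \<phi> (f_test j a))) \<le> ennreal C * ennreal K"
  proof (rule SUP_least)
    fix a assume a: "a \<in> disc"
    have "B1_norm (f_test j a) \<le> ennreal K"
      using B1_norm_f_test_bound[OF a j] by (simp add: K_def)
    then show "Z_norm \<alpha> (T2 u v \<phi> (f_test j a)) \<le> ennreal C * ennreal K"
      by (intro order_trans[OF C[OF f_test_in_B1[OF a j]]] mult_left_mono) simp_all
  qed
  also have "\<dots> < \<infinity>" by (simp add: ennreal_mult_less_top)
  finally show ?thesis .
qed

private lemma weighted_bdd_coeff_divide:
  assumes tests: "\<forall>j\<in>{1..5}. (SUP a\<in>disc. Z_norm \<alpha> (T2 u v \<phi> (f_test j a))) < \<infinity>"
    and coeff: "\<forall>k\<le>4. weighted_bdd \<alpha> (\<lambda>z. norm (A k z))"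
    and k: "k \<le> 4"
  shows "weighted_bdd \<alpha> (\<lambda>z. norm (A k z) / (1 - (norm (\<phi> z))\<^sup>2) ^ k)"
proof -
  define M where "M j = enn2real (SUP a\<in>disc. Z_norm \<alpha> (T2 u v \<phi> (f_test j a)))" for j
  have bnd: "(1 - (norm z)\<^sup>2) powr \<alpha> * norm (\<Sum>k\<le>4. A k z * (deriv ^^ k) (f_test j a) (\<phi> z)) \<le> sum M {1..5}"
    if j: "j \<in> {1..5}" and a: "a \<in> disc" and z: "z \<in> disc" for j a z
  proof -
    have "ennreal ((1 - (norm z)\<^sup>2) powr \<alpha> * norm (deriv (deriv (T2 u v \<phi> (f_test j a))) z))
        \<le> Z_norm \<alpha> (T2 u v \<phi> (f_test j a))"
      unfolding Z_norm_def by (rule order_trans[OF SUP_upper[OF z]]) simp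
    also have "\<dots> \<le> (SUP a\<in>disc. Z_norm \<alpha> (T2 u v \<phi> (f_test j a)))"
      using a by (rule SUP_upper)
    also have "\<dots> = ennreal (M j)" using tests j by (simp add: M_def)
    finally have "(1 - (norm z)\<^sup>2) powr \<alpha> * norm (deriv (deriv (T2 u v \<phi> (f_test j a))) z) \<le> M j"
      by (simp add: M_def)
    \<comment> \<open>The linear system lemma takes one bound for all equations; the sum of the five
      bounds provides it.\<close>
    also have "M j \<le> sum M {1..5}" using j by (intro member_le_sum) (auto simp: M_def)
    finally show ?thesis by (simp only: T2_deriv(3)[OF f_test_holomorphic[OF a] z])
  qed
  \<comment> \<open>First index 1 and \<open>n = 4\<close>: five equations, from the five test
    exponents, for the five coefficients.\<close>
  obtain C where C: "\<And>(X :: nat \<Rightarrow> complex) M. (\<forall>j\<in>{1..1+4}. norm (\<Sum>k\<le>4. pochhammer (of_nat j) k * X k) \<le> M)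
      \<Longrightarrow> (\<forall>k\<le>4. norm (X k) \<le> C * M)"
    using pochhammer_system_bound[of 1 4] by metis
  have "weighted_bdd \<alpha> (\<lambda>z. norm (A k z) * (norm (\<phi> z) / (1 - (norm (\<phi> z))\<^sup>2)) ^ k)"
    unfolding weighted_bdd_def
  proof (intro exI ballI)
    fix z assume z: "z \<in> disc"
    define w where "w = \<phi> z"
    define D where "D = 1 - (norm w)\<^sup>2"
    define W where "W = (1 - (norm z)\<^sup>2) powr \<alpha>"
    define X where "X k = of_real W * (A k z * (cnj w / of_real D) ^ k)" for k
    have w: "w \<in> disc" using z \<phi>_disc by (auto simp: w_def)
    then have D: "D > 0" by (simp add: D_def mem_disc_iff abs_square_less_1)
    have W: "W \<ge> 0" by (simp add: W_def)
    have "\<forall>j\<in>{1..1+4}. norm (\<Sum>k\<le>4. pochhammer (of_nat j) k * X k) \<le> sum M {1..5}"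
    proof
      fix j :: nat assume j: "j \<in> {1..1+4}"
      have cw: "1 - cnj w * w = of_real D"
        by (simp add: D_def complex_norm_square mult.commute del: of_real_power)
      \<comment> \<open>At the point \<open>w\<close> itself \<open>1 - cnj w * w\<close> is
        \<open>D\<close>, so the numerator \<open>D ^ j\<close> cancels and \<open>j\<close>
        survives only in the rising factorial.\<close>
      have ft: "(deriv ^^ k) (f_test j w) w = pochhammer (of_nat j) k * (cnj w / of_real D) ^ k" for k
        using f_test_higher_deriv[OF w w, of k j] D
        unfolding cw one_minus_norm_sq_real D_def[symmetric] by (simp add: power_add power_divide)
      have "(\<Sum>k\<le>4. pochhammer (of_nat j) k * X k) = of_real W * (\<Sum>k\<le>4. A k z * (deriv ^^ k) (f_test j w) w)"
        unfolding sum_distrib_left X_def ft by (intro sum.cong refl) (simp only: mult_ac)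
      then have "norm (\<Sum>k\<le>4. pochhammer (of_nat j) k * X k) = W * norm (\<Sum>k\<le>4. A k z * (deriv ^^ k) (f_test j w) w)"
        using W by (simp add: norm_mult)
      also have "\<dots> \<le> sum M {1..5}"
        using bnd[of j w z] j w z by (simp add: W_def w_def)
      finally show "norm (\<Sum>k\<le>4. pochhammer (of_nat j) k * X k) \<le> sum M {1..5}" .
    qed
    from C[OF this] k have "norm (X k) \<le> C * sum M {1..5}" by blast
    moreover have "norm (X k) = W * (norm (A k z) * (norm w / D) ^ k)"
      using W D by (simp add: X_def norm_mult norm_power norm_divide)
    ultimately show "(1 - (norm z)\<^sup>2) powr \<alpha> * (norm (A k z) * (norm (\<phi> z) / (1 - (norm (\<phi> z))\<^sup>2)) ^ k) \<le> C * sum M {1..5}"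
      by (simp only: W_def w_def D_def)
  qed
  then have "weighted_bdd \<alpha> (\<lambda>z. 2 ^ k * (norm (A k z) * (norm (\<phi> z) / (1 - (norm (\<phi> z))\<^sup>2)) ^ k) + 2 ^ k * norm (A k z))"
    using coeff k by (intro weighted_bdd_add weighted_bdd_cmult) auto
  then show ?thesis
  proof (rule weighted_bdd_mono)
    fix z assume "z \<in> disc"
    then have w: "norm (\<phi> z) < 1" using \<phi>_disc by (auto simp: mem_disc_iff image_subset_iff)
    define s where "s = norm (\<phi> z)"
    have D: "1 - s\<^sup>2 > 0" "s \<ge> 0" using w by (simp_all add: s_def abs_square_less_1)
    \<comment> \<open>The system yields the quotient only with an extra factor \<open>s ^ k\<close>.
      For \<open>s \<ge> 1 / 2\<close> it is removed at the cost of \<open>2 ^ k\<close>; for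
      smaller \<open>s\<close> the denominator stays away from 0 and the bound on the coefficient
      alone is enough.\<close>
    have "1 / (1 - s\<^sup>2) ^ k \<le> 2 ^ k * (s / (1 - s\<^sup>2)) ^ k + 2 ^ k"
    proof (cases "s \<ge> 1 / 2")
      case True
      then have "1 / (1 - s\<^sup>2) ^ k \<le> (2 * s) ^ k / (1 - s\<^sup>2) ^ k"
        using D by (intro divide_right_mono one_le_power) auto
      then show ?thesis by (simp add: power_mult_distrib power_divide add_increasing2)
    next
      case False
      then have "s\<^sup>2 \<le> (1 / 2)\<^sup>2" using D by (intro power_mono) auto
      then have "1 / (1 - s\<^sup>2) \<le> 2" using D by (simp add: divide_simps power2_eq_square)
      then have "(1 / (1 - s\<^sup>2)) ^ k \<le> 2 ^ k" using D by (intro power_mono) auto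
      then show ?thesis using D by (simp add: power_divide add_increasing)
    qed
    from mult_left_mono[OF this, of "norm (A k z)"]
    show "norm (A k z) / (1 - (norm (\<phi> z))\<^sup>2) ^ k
      \<le> 2 ^ k * (norm (A k z) * (norm (\<phi> z) / (1 - (norm (\<phi> z))\<^sup>2)) ^ k) + 2 ^ k * norm (A k z)"
      by (simp add: s_def algebra_simps)
  qed
qed

section \<open>Sufficiency of the growth conditions\<close>

private lemma weighted_bdd_coeff_divide_imp_T2_bounded:
  assumes coeff: "\<forall>k\<le>4. weighted_bdd \<alpha> (\<lambda>z. norm (A k z) / (1 - (norm (\<phi> z))\<^sup>2) ^ k)"
  shows "T2_bounded \<alpha> u v \<phi>"
proof -
  have "\<exists>M. \<forall>k\<le>4. \<forall>z\<in>disc. (1 - (norm z)\<^sup>2) powr \<alpha> * (norm (A k z) / (1 - (norm (\<phi> z))\<^sup>2) ^ k) \<le> M k"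
    using coeff unfolding weighted_bdd_def by metis
  then obtain M where M: "\<And>k z. k \<le> 4 \<Longrightarrow> z \<in> disc
      \<Longrightarrow> (1 - (norm z)\<^sup>2) powr \<alpha> * (norm (A k z) / (1 - (norm (\<phi> z))\<^sup>2) ^ k) \<le> M k"
    by metis
  define B :: "nat \<Rightarrow> real" where "B k = 8 * fact k * 4 ^ k" for k
  define b where "b k = B k / (1 - (norm (\<phi> 0))\<^sup>2) ^ k" for k
  \<comment> \<open>\<open>K0\<close>, \<open>K1\<close> and \<open>K2\<close> bound the three parts
    of \<open>Z_norm\<close>. The first two concern only the point 0, where \<open>b k\<close>
    bounds the derivatives of \<open>f\<close> at \<open>\<phi> 0\<close>.\<close>
  define K0 where "K0 = norm (u 0) * b 0 + norm (v 0) * b 2"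
  define K1 where "K1 = norm (deriv u 0) * b 0 + norm (u 0 * deriv \<phi> 0) * b 1
    + norm (deriv v 0) * b 2 + norm (v 0 * deriv \<phi> 0) * b 3"
  define K2 where "K2 = (\<Sum>k\<le>4. M k * B k)"
  have zero: "0 \<in> disc" by (simp add: mem_disc_iff)
  have \<phi>1: "1 - (norm (\<phi> z))\<^sup>2 > 0" if "z \<in> disc" for z
    using \<phi>_disc that by (auto simp: mem_disc_iff image_subset_iff abs_square_less_1)
  have B: "B k \<ge> 0" for k by (simp add: B_def)
  have b: "b k \<ge> 0" for k using B[of k] \<phi>1[OF zero] by (simp add: b_def)
  have K: "K0 \<ge> 0" "K1 \<ge> 0" by (simp_all add: K0_def K1_def b)
  have K2: "K2 \<ge> 0"
    unfolding K2_def
  proof (intro sum_nonneg mult_nonneg_nonneg B)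
    fix k :: nat assume "k \<in> {..4}"
    \<comment> \<open>\<open>M k\<close> dominates a nonnegative quantity at the point 0. The sign
      allows the final estimates to be added in \<open>ennreal\<close>.\<close>
    then show "0 \<le> M k"
      using \<phi>1[OF zero] by (intro order_trans[OF _ M[of k 0]] mult_nonneg_nonneg divide_nonneg_nonneg) (auto simp: zero)
  qed
  have main: "Z_norm \<alpha> (T2 u v \<phi> f) \<le> ennreal (K0 + K1 + K2) * B1_norm f" if f: "in_B1 f" for f
  proof -
    define N where "N = enn2real (B1_norm f)"
    have hol: "f holomorphic_on disc" and N: "B1_norm f = ennreal N" "N \<ge> 0"
      using f by (auto simp: in_B1_def N_def)
    have fb: "norm ((deriv ^^ k) f (\<phi> z)) \<le> B k * N / (1 - (norm (\<phi> z))\<^sup>2) ^ k" if "z \<in> disc" for k z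
      using in_B1_higher_deriv_bound[OF f, of "\<phi> z" k] that \<phi>_disc by (auto simp: B_def N_def)
    have fb0: "norm (c * (deriv ^^ k) f (\<phi> 0)) \<le> norm c * b k * N" for c k
      using mult_left_mono[OF fb[OF zero, of k] norm_ge_zero[of c]] by (simp add: b_def norm_mult)
    have "T2 u v \<phi> f 0 = u 0 * (deriv ^^ 0) f (\<phi> 0) + v 0 * (deriv ^^ 2) f (\<phi> 0)"
      by (simp add: T2_def numeral_2_eq_2)
    then have "norm (T2 u v \<phi> f 0) \<le> norm (u 0) * b 0 * N + norm (v 0) * b 2 * N"
      by (auto simp only: intro!: norm_triangle_le add_mono fb0)
    then have n0: "norm (T2 u v \<phi> f 0) \<le> K0 * N" by (simp add: K0_def algebra_simps)
    have "deriv (T2 u v \<phi> f) 0 = deriv u 0 * (deriv ^^ 0) f (\<phi> 0) + u 0 * deriv \<phi> 0 * (deriv ^^ 1) f (\<phi> 0)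
        + deriv v 0 * (deriv ^^ 2) f (\<phi> 0) + v 0 * deriv \<phi> 0 * (deriv ^^ 3) f (\<phi> 0)"
      using T2_deriv(2)[OF hol zero] by simp
    then have "norm (deriv (T2 u v \<phi> f) 0) \<le> norm (deriv u 0) * b 0 * N + norm (u 0 * deriv \<phi> 0) * b 1 * N
        + norm (deriv v 0) * b 2 * N + norm (v 0 * deriv \<phi> 0) * b 3 * N"
      by (auto simp only: intro!: norm_triangle_le add_mono fb0)
    then have n1: "norm (deriv (T2 u v \<phi> f) 0) \<le> K1 * N" by (simp add: K1_def algebra_simps)
    have n2: "(1 - (norm z)\<^sup>2) powr \<alpha> * norm (deriv (deriv (T2 u v \<phi> f)) z) \<le> K2 * N" if z: "z \<in> disc" for z
    proof -
      define W where "W = (1 - (norm z)\<^sup>2) powr \<alpha>"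
      have W: "W \<ge> 0" by (simp add: W_def)
      have "W * norm (deriv (deriv (T2 u v \<phi> f)) z) \<le> W * (\<Sum>k\<le>4. norm (A k z * (deriv ^^ k) f (\<phi> z)))"
        unfolding T2_deriv(3)[OF hol z] by (intro mult_left_mono norm_sum W)
      also have "\<dots> = (\<Sum>k\<le>4. W * norm (A k z) * norm ((deriv ^^ k) f (\<phi> z)))"
        by (simp only: sum_distrib_left norm_mult mult.assoc)
      also have "\<dots> \<le> (\<Sum>k\<le>4. W * norm (A k z) * (B k * N / (1 - (norm (\<phi> z))\<^sup>2) ^ k))"
        using W by (intro sum_mono mult_left_mono fb z) auto
      also have "\<dots> = (\<Sum>k\<le>4. W * (norm (A k z) / (1 - (norm (\<phi> z))\<^sup>2) ^ k) * (B k * N))"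
        by (intro sum.cong) auto
      also have "\<dots> \<le> (\<Sum>k\<le>4. M k * (B k * N))"
        using B N M[OF _ z] by (intro sum_mono mult_right_mono) (auto simp: W_def)
      also have "\<dots> = K2 * N" by (simp add: K2_def sum_distrib_right mult.assoc)
      finally show ?thesis by (simp add: W_def)
    qed
    have "Z_norm \<alpha> (T2 u v \<phi> f) \<le> ennreal (K0 * N) + ennreal (K1 * N) + ennreal (K2 * N)"
      unfolding Z_norm_def by (intro add_mono SUP_least ennreal_leI n0 n1 n2)
    also have "\<dots> = ennreal (K0 + K1 + K2) * B1_norm f"
      using K K2 N by (simp add: algebra_simps flip: ennreal_plus ennreal_mult)
    finally show ?thesis .
  qed
  show ?thesis unfolding T2_bounded_def
    by (intro exI[of _ "K0 + K1 + K2"] allI impI conjI main T2_deriv(1)) (auto simp: in_B1_def)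
qed

text \<open>Both equivalences follow from the cycle (i) to (ii) to (iii) to (i).\<close>

lemma T2_bounded_iff:
  defines "tests \<equiv> \<forall>j\<in>{1..5}. (SUP a\<in>disc. Z_norm \<alpha> (T2 u v \<phi> (f_test j a))) < \<infinity>"
  shows "T2_bounded \<alpha> u v \<phi> \<longleftrightarrow> tests \<and> (\<forall>k\<le>4. weighted_bdd \<alpha> (\<lambda>z. norm (T2_coeff u v \<phi> k z)))"
    and "T2_bounded \<alpha> u v \<phi> \<longleftrightarrow>
      (\<forall>k\<le>4. weighted_bdd \<alpha> (\<lambda>z. norm (T2_coeff u v \<phi> k z) / (1 - (norm (\<phi> z))\<^sup>2) ^ k))"
proof -
  have "tests \<and> (\<forall>k\<le>4. weighted_bdd \<alpha> (\<lambda>z. norm (A k z)))" if T: "T2_bounded \<alpha> u v \<phi>"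
    unfolding tests_def
    using T2_bounded_imp_f_test_bounded[OF T] T2_bounded_imp_weighted_bdd_coeff[OF T] by auto
  moreover have "\<forall>k\<le>4. weighted_bdd \<alpha> (\<lambda>z. norm (A k z) / (1 - (norm (\<phi> z))\<^sup>2) ^ k)"
    if "tests" "\<forall>k\<le>4. weighted_bdd \<alpha> (\<lambda>z. norm (A k z))"
    using weighted_bdd_coeff_divide[OF that[unfolded tests_def]] by blast
  moreover note weighted_bdd_coeff_divide_imp_T2_bounded
  ultimately show "T2_bounded \<alpha> u v \<phi> \<longleftrightarrow> tests \<and> (\<forall>k\<le>4. weighted_bdd \<alpha> (\<lambda>z. norm (A k z)))"
    and "T2_bounded \<alpha> u v \<phi> \<longleftrightarrow>
      (\<forall>k\<le>4. weighted_bdd \<alpha> (\<lambda>z. norm (A k z) / (1 - (norm (\<phi> z))\<^sup>2) ^ k))"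
    by satx+
qed

end

lemma all_atMost_4: "(\<forall>k\<le>4. P k) \<longleftrightarrow> P 0 \<and> P 1 \<and> P 2 \<and> P 3 \<and> P (4::nat)"
proof
  assume "P 0 \<and> P 1 \<and> P 2 \<and> P 3 \<and> P 4"
  moreover have "k \<le> 4 \<Longrightarrow> k = 0 \<or> k = 1 \<or> k = 2 \<or> k = 3 \<or> k = 4" for k :: nat by arith
  ultimately show "\<forall>k\<le>4. P k" by metis
qed auto

theorem theorem2p6:
  fixes \<alpha> :: real and u v \<phi> :: "complex \<Rightarrow> complex"
  assumes "\<alpha> > 0"
    and "u holomorphic_on disc" and "v holomorphic_on disc" and "\<phi> holomorphic_on disc"
    and "\<phi> ` disc \<subseteq> disc"
  shows "(T2_bounded \<alpha> u v \<phi> \<longleftrightarrow>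
           ((\<forall>j\<in>{1..5}. (SUP a\<in>disc. Z_norm \<alpha> (T2 u v \<phi> (f_test j a))) < \<infinity>)
            \<and> (SUP z\<in>disc. ennreal ((1 - (norm z)\<^sup>2) powr \<alpha> *
                  (norm (deriv (deriv u) z)
                   + norm (2 * deriv u z * deriv \<phi> z + u z * deriv (deriv \<phi>) z)
                   + norm (u z * (deriv \<phi> z)\<^sup>2 + deriv (deriv v) z)))) < \<infinity>
            \<and> (SUP z\<in>disc. ennreal ((1 - (norm z)\<^sup>2) powr \<alpha> *
                  (norm (2 * deriv v z * deriv \<phi> z + v z * deriv (deriv \<phi>) z)
                   + norm (v z * (deriv \<phi> z)\<^sup>2)))) < \<infinity>))
       \<and> (T2_bounded \<alpha> u v \<phi> \<longleftrightarrow>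
           ((SUP z\<in>disc. ennreal ((1 - (norm z)\<^sup>2) powr \<alpha> *
                  (norm (deriv (deriv u) z)
                   + norm (2 * deriv u z * deriv \<phi> z + u z * deriv (deriv \<phi>) z)
                       / (1 - (norm (\<phi> z))\<^sup>2)
                   + norm (u z * (deriv \<phi> z)\<^sup>2 + deriv (deriv v) z)
                       / (1 - (norm (\<phi> z))\<^sup>2)\<^sup>2))) < \<infinity>
            \<and> (SUP z\<in>disc. ennreal ((1 - (norm z)\<^sup>2) powr \<alpha> *
                  (norm (2 * deriv v z * deriv \<phi> z + v z * deriv (deriv \<phi>) z)
                       / (1 - (norm (\<phi> z))\<^sup>2) ^ 3
                   + norm (v z * (deriv \<phi> z)\<^sup>2) / (1 - (norm (\<phi> z))\<^sup>2) ^ 4))) < \<infinity>))"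
proof -
  \<comment> \<open>This makes the denominators, and hence all summands, nonnegative, so that the
    weighted sums split into their terms.\<close>
  have \<phi>1: "(norm (\<phi> z))\<^sup>2 \<le> 1" if "z \<in> disc" for z
    using assms(5) that by (force simp: mem_disc_iff image_subset_iff abs_square_le_1 less_imp_le)
  have coeff: "T2_coeff u v \<phi> 0 z = deriv (deriv u) z"
      "T2_coeff u v \<phi> 1 z = 2 * deriv u z * deriv \<phi> z + u z * deriv (deriv \<phi>) z"
      "T2_coeff u v \<phi> 2 z = u z * (deriv \<phi> z)\<^sup>2 + deriv (deriv v) z"
      "T2_coeff u v \<phi> 3 z = 2 * deriv v z * deriv \<phi> z + v z * deriv (deriv \<phi>) z"
      "T2_coeff u v \<phi> 4 z = v z * (deriv \<phi> z)\<^sup>2" for z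
    by (simp_all add: T2_coeff_def)
  show ?thesis
    unfolding SUP_weighted_finite_iff
    using T2_bounded_iff[OF assms(2-5), of \<alpha>]
    unfolding all_atMost_4 coeff
    by (simp add: weighted_bdd_add_iff \<phi>1)
qed

end
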